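(* Let $L$ be a complex with $[L]\le [S^n]$ for some integer $n\ge 0$. Let $Y$ be a metrizable compactum, $X$ a Polish space with $\operatorname{ed}(X)\le [L]$, and $F:X\to Y$ a lower semi-continuous many-valued map such that the collection $\{F(x): x\in X\}$ is equi-$LC^{[L]}$ and $F(x)\in \operatorname{AE}([L])$ for each $x\in X$. Let $A\subseteq X$ be a closed subset. Then any continuous selection $f:A\to Y$ of $F|_A$ can be extended to a continuous selection $\bar f:X\to Y$ of $F$.
   Context: Conventions: all spaces are Polish (separable, completely metrizable); all complexes are countable finitely dominated CW complexes; all single-valued maps are continuous. For spaces $Z$ and $W$, $W\in \operatorname{AE}(Z)$ means that every map $A\to W$ defined on a closed subspace $A\subseteq Z$ extends to a map $Z\to W$. For complexes $L,K$, write $L\le K$ if for each (Polish) space $Z$, $L\in\operatorname{AE}(Z)$ implies $K\in \operatorname{AE}(Z)$; the equivalence classes for this preorder are called extension types, the class of $L$ is denoted $[L]$, and $\le$ induces an order on extension types. $S^n$ is the $n$-sphere. The extension dimension of $Z$ is the extension type $\operatorname{ed}(Z)=\min\{[L]: L\in \operatorname{AE}(Z)\}$; thus $\operatorname{ed}(Z)\le [L]$ if and only if $L\in\operatorname{AE}(Z)$. A space $W$ is an absolute extensor modulo $L$, written $W\in\operatorname{AE}([L])$, if $W\in \operatorname{AE}(Z)$ for every Polish space $Z$ with $\operatorname{ed}(Z)\le [L]$. Fix a metric on the compactum $Y$. A collection $\{F_\alpha\}_{\alpha}$ of closed subsets of $Y$ is equi-$LC^{[L]}$ if for every $\varepsilon>0$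 there is $\delta>0$ such that for each $\alpha$, each Polish space $Z$ with $\operatorname{ed}(Z)\le [L]$, each closed $A\subseteq Z$ and each map $f:A\to F_\alpha$ with $\operatorname{diam} f(A)<\delta$, there is an extension $\bar f:Z\to F_\alpha$ of $f$ with $\operatorname{diam}\bar f(Z)<\varepsilon$. A many-valued map $F:X\to Y$ (assigning to each $x\in X$ a subset $F(x)\subseteq Y$) is lower semi-continuous if each $F(x)$ is closed in $Y$ and for every open $U\subseteq Y$ the set $\{x\in X: F(x)\cap U\neq\varnothing\}$ is open in $X$. A selection of $F$ (resp. of $F|_A$) is a map $f$ on $X$ (resp. on $A$) with $f(x)\in F(x)$ for all $x$ in its domain. *)

theory Defs
  imports "HOL-Analysis.Analysis"
begin

section \<open>Polish spaces\<close>

definition polish :: "'a topology \<Rightarrow> bool" where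
  "polish Z \<longleftrightarrow> separable_space Z \<and> completely_metrizable_space Z"

section \<open>CW complexes\<close>

definition disc :: "nat \<Rightarrow> (nat \<Rightarrow> real) topology" where
  "disc n = subtopology (Euclidean_space n) {x. (\<Sum>i<n. (x i)\<^sup>2) \<le> 1}"

definition open_disc :: "nat \<Rightarrow> (nat \<Rightarrow> real) set" where
  "open_disc n = topspace (Euclidean_space n) \<inter> {x. (\<Sum>i<n. (x i)\<^sup>2) < 1}"

definition disc_boundary :: "nat \<Rightarrow> (nat \<Rightarrow> real) set" where
  "disc_boundary n = topspace (Euclidean_space n) \<inter> {x. (\<Sum>i<n. (x i)\<^sup>2) = 1}"

text \<open>
  A cell structure on \<open>X\<close> is the set \<open>E\<close> of its open cells together with their dimensions \<open>dm\<close>.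
  The last two conditions are closure-finiteness (inside the characteristic map) and the weak
  topology. For \<open>n = 0\<close> the disc is a point with empty boundary.
\<close>
definition CW_structure :: "'a topology \<Rightarrow> 'a set set \<Rightarrow> ('a set \<Rightarrow> nat) \<Rightarrow> bool" where
  "CW_structure X E dm \<longleftrightarrow>
     Hausdorff_space X \<and>
     pairwise disjnt E \<and> \<Union>E = topspace X \<and>
     (\<forall>e\<in>E. \<exists>\<Phi>.
        continuous_map (disc (dm e)) X \<Phi> \<and>
        homeomorphic_map (subtopology (disc (dm e)) (open_disc (dm e))) (subtopology X e) \<Phi> \<and>
        (\<exists>S. finite S \<and> S \<subseteq> E \<and> (\<forall>s\<in>S. dm s < dm e) \<and> \<Phi> ` disc_boundary (dm e) \<subseteq> \<Union>S)) \<and>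
     (\<forall>C. C \<subseteq> topspace X \<longrightarrow> (\<forall>e\<in>E. closedin X (C \<inter> X closure_of e)) \<longrightarrow> closedin X C)"

definition countable_CW :: "'a topology \<Rightarrow> bool" where
  "countable_CW X \<longleftrightarrow> (\<exists>E dm. CW_structure X E dm \<and> countable E)"

definition finite_CW :: "'a topology \<Rightarrow> bool" where
  "finite_CW X \<longleftrightarrow> (\<exists>E dm. CW_structure X E dm \<and> finite E)"

text \<open>
  HOL cannot quantify over types inside a formula. Polish spaces and countable CW complexes have
  at most continuum many points, so every one of them is homeomorphic to a topology whose points
  are real numbers (lemmas \<open>polish_real_copy\<close> and \<open>countable_CW_real_copy\<close> below); an unrestricted
  quantifier over such spaces is therefore rendered as a quantifier over \<open>real topology\<close>. The
  topologies in question are arbitrary; they need not be related to the usual one on the reals.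
\<close>

definition finitely_dominated :: "'a topology \<Rightarrow> bool" where
  "finitely_dominated X \<longleftrightarrow>
     (\<exists>(P :: real topology) i r. finite_CW P \<and> continuous_map X P i \<and> continuous_map P X r \<and>
        homotopic_with (\<lambda>_. True) X X (r \<circ> i) id)"

definition cplx :: "'a topology \<Rightarrow> bool" where
  "cplx L \<longleftrightarrow> countable_CW L \<and> finitely_dominated L"

section \<open>Absolute extensors and extension dimension\<close>

text \<open>\<open>abs_ext Z W\<close> is \<open>W \<in> AE(Z)\<close>.\<close>
definition abs_ext :: "'a topology \<Rightarrow> 'b topology \<Rightarrow> bool" where
  "abs_ext Z W \<longleftrightarrow>
     (\<forall>A f. closedin Z A \<and> continuous_map (subtopology Z A) W f \<longrightarrow>
        (\<exists>g. continuous_map Z W g \<and> (\<forall>x\<in>A. g x = f x)))"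

text \<open>\<open>ext_le L K\<close> is \<open>[L] \<le> [K]\<close>.\<close>
definition ext_le :: "'a topology \<Rightarrow> 'b topology \<Rightarrow> bool" where
  "ext_le L K \<longleftrightarrow> (\<forall>Z :: real topology. polish Z \<and> abs_ext Z L \<longrightarrow> abs_ext Z K)"

text \<open>
  \<open>ed_le Z L\<close> is \<open>ed(Z) \<le> [L]\<close>, where \<open>ed(Z) = min {[K]. K \<in> AE(Z)}\<close>. The minimum of a set lies below
  \<open>[L]\<close> iff some member of the set does, and in this form the relation does not depend on a proof
  that the minimum exists. See \<open>ed_le_iff_least\<close> for the agreement with the minimum and \<open>ed_le_iff\<close>
  for the equivalence with \<open>L \<in> AE(Z)\<close>.
\<close>
definition ed_le :: "'a topology \<Rightarrow> 'b topology \<Rightarrow> bool" where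
  "ed_le Z L \<longleftrightarrow> (\<exists>K :: real topology. cplx K \<and> abs_ext Z K \<and> ext_le K L)"

text \<open>\<open>abs_ext_mod L W\<close> is \<open>W \<in> AE([L])\<close>.\<close>
definition abs_ext_mod :: "'a topology \<Rightarrow> 'b topology \<Rightarrow> bool" where
  "abs_ext_mod L W \<longleftrightarrow> (\<forall>Z :: real topology. polish Z \<and> ed_le Z L \<longrightarrow> abs_ext Z W)"

section \<open>Families of closed sets and many-valued maps\<close>

text \<open>
  The members of \<open>\<F>\<close> are meant to lie in one compact set, so that all diameters are those of bounded
  sets; \<open>diameter {} = 0\<close>.
\<close>
definition equi_LC :: "'a topology \<Rightarrow> 'b::metric_space set set \<Rightarrow> bool" where
  "equi_LC L \<F> \<longleftrightarrow>
     (\<forall>\<epsilon>>0. \<exists>\<delta>>0. \<forall>T\<in>\<F>. \<forall>(Z :: real topology) A f.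
        polish Z \<and> ed_le Z L \<and> closedin Z A \<and>
        continuous_map (subtopology Z A) (top_of_set T) f \<and> diameter (f ` A) < \<delta> \<longrightarrow>
        (\<exists>g. continuous_map Z (top_of_set T) g \<and> (\<forall>x\<in>A. g x = f x) \<and>
             diameter (g ` topspace Z) < \<epsilon>))"

definition many_valued_map :: "'a topology \<Rightarrow> 'b topology \<Rightarrow> ('a \<Rightarrow> 'b set) \<Rightarrow> bool" where
  "many_valued_map X Y F \<longleftrightarrow> (\<forall>x\<in>topspace X. F x \<subseteq> topspace Y)"

definition lower_semicontinuous :: "'a topology \<Rightarrow> 'b topology \<Rightarrow> ('a \<Rightarrow> 'b set) \<Rightarrow> bool" where
  "lower_semicontinuous X Y F \<longleftrightarrow>
     (\<forall>x\<in>topspace X. closedin Y (F x)) \<and>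
     (\<forall>U. openin Y U \<longrightarrow> openin X {x \<in> topspace X. F x \<inter> U \<noteq> {}})"

text \<open>A continuous selection of the restriction of \<open>F\<close> to \<open>A\<close>.\<close>
definition selection_on ::
  "'a topology \<Rightarrow> 'b topology \<Rightarrow> ('a \<Rightarrow> 'b set) \<Rightarrow> 'a set \<Rightarrow> ('a \<Rightarrow> 'b) \<Rightarrow> bool" where
  "selection_on X Y F A f \<longleftrightarrow> continuous_map (subtopology X A) Y f \<and> (\<forall>x\<in>A. f x \<in> F x)"

section \<open>Agreement with the unrestricted quantifiers\<close>

lemma real_copy:
  assumes "topspace X \<lesssim> (UNIV :: real set)"
  shows "\<exists>X' :: real topology. X homeomorphic_space X'"
proof -
  obtain g :: "'a \<Rightarrow> real" where g: "inj_on g (topspace X)"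
    using assms by (auto simp: lepoll_def)
  define h where "h = inv_into (topspace X) g"
  define X' where "X' = pullback_topology (g ` topspace X) h X"
  have hg: "h (g x) = x" if "x \<in> topspace X" for x
    using g that by (simp add: h_def)
  have tX': "topspace X' = g ` topspace X"
    by (auto simp: X'_def topspace_pullback_topology hg)
  have "continuous_map X' X (id \<circ> h)"
    unfolding X'_def by (rule continuous_map_pullback) simp
  moreover have "continuous_map X X' g"
    unfolding X'_def
  proof (rule continuous_map_pullback')
    show "continuous_map X X (h \<circ> g)"
      by (rule continuous_map_eq [of X X id]) (auto simp: hg)
  qed auto
  ultimately have "homeomorphic_maps X X' g h"
    by (auto simp: homeomorphic_maps_def tX' hg)
  then show ?thesis
    by (auto simp: homeomorphic_space_def)
qed

lemma lepoll_real_if_inj: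
  fixes c :: "'a \<Rightarrow> (nat \<times> nat) set"
  assumes "inj_on c S"
  shows "S \<lesssim> (UNIV :: real set)"
proof -
  have "S \<lesssim> (UNIV :: nat set set)"
    unfolding lepoll_def
    by (rule exI [of _ "\<lambda>x. prod_encode ` c x"])
       (use assms inj_image_eq_iff [OF inj_prod_encode] in \<open>auto simp: inj_on_def\<close>)
  then show ?thesis
    using lepoll_trans eqpoll_imp_lepoll nat_sets_eqpoll_reals by blast
qed

lemma polish_real_copy:
  assumes "polish Z"
  shows "\<exists>Z' :: real topology. Z homeomorphic_space Z' \<and> polish Z'"
proof -
  obtain M d where "Metric_space M d" and Z: "Z = Metric_space.mtopology M d"
    using assms by (auto simp: polish_def completely_metrizable_space_def)
  interpret Metric_space M d by fact
  obtain C where C: "countable C" "C \<subseteq> topspace Z" "Z closure_of C = topspace Z"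
    using assms by (auto simp: polish_def separable_space_def)
  define c where "c x = {(to_nat_on C q, n) |q n. q \<in> C \<and> d x q < inverse (Suc n)}" for x
  have "inj_on c M"
  proof (rule inj_onI, rule ccontr)
    fix x y assume xy: "x \<in> M" "y \<in> M" "c x = c y" "x \<noteq> y"
    then obtain n where n: "inverse (real (Suc n)) < d x y / 2"
      using reals_Archimedean [of "d x y / 2"] by auto
    have "x \<in> mtopology closure_of C"
      using C xy by (simp add: Z)
    then obtain q where q: "q \<in> C" "q \<in> M" "d x q < inverse (Suc n)"
      by (auto simp: metric_closure_of dest!: spec [of _ "inverse (real (Suc n))"])
    then have "(to_nat_on C q, n) \<in> c x"
      unfolding c_def by blast
    then have "(to_nat_on C q, n) \<in> c y"
      using xy by simp
    then obtain q' where "q' \<in> C" "to_nat_on C q' = to_nat_on C q" "d y q' < inverse (Suc n)"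
      by (auto simp: c_def)
    then have "d y q < inverse (Suc n)"
      using C q by (metis to_nat_on_inj)
    then have "d x y < d x y"
      using triangle [of x q y] q xy n by (simp add: commute [of q y])
    then show False by simp
  qed
  then have "topspace Z \<lesssim> (UNIV :: real set)"
    using lepoll_real_if_inj by (simp add: Z)
  then obtain Z' :: "real topology" where Z': "Z homeomorphic_space Z'"
    using real_copy by blast
  then have "polish Z'"
    using assms homeomorphic_separable_space homeomorphic_completely_metrizable_space
    unfolding polish_def by blast
  with Z' show ?thesis by blast
qed

lemma countable_CW_real_copy:
  assumes "countable_CW X"
  shows "\<exists>X' :: real topology. X homeomorphic_space X'"
proof (rule real_copy)
  obtain E dm where E: "CW_structure X E dm" "countable E"
    using assms by (auto simp: countable_CW_def)
  have "\<exists>k :: 'a \<Rightarrow> (nat \<Rightarrow> real). inj_on k e" if e: "e \<in> E" for e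
  proof -
    have "\<forall>e\<in>E. \<exists>\<Phi>.
        homeomorphic_map (subtopology (disc (dm e)) (open_disc (dm e))) (subtopology X e) \<Phi>"
      using E(1) unfolding CW_structure_def by (elim conjE) blast
    with e obtain \<Phi> where
      "homeomorphic_map (subtopology (disc (dm e)) (open_disc (dm e))) (subtopology X e) \<Phi>"
      by blast
    then obtain k where
      "homeomorphic_map (subtopology X e) (subtopology (disc (dm e)) (open_disc (dm e))) k"
      by (metis homeomorphic_map_maps homeomorphic_maps_sym)
    moreover have "\<Union>E = topspace X"
      using E(1) unfolding CW_structure_def by (elim conjE)
    then have "topspace (subtopology X e) = e"
      using e by auto
    ultimately show ?thesis
      by (metis homeomorphic_imp_injective_map)
  qed
  then obtain k :: "'a set \<Rightarrow> 'a \<Rightarrow> (nat \<Rightarrow> real)" where k: "\<And>e. e \<in> E \<Longrightarrow> inj_on (k e) e"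
    by metis
  obtain b :: "real \<Rightarrow> nat set" where b: "inj b"
    using nat_sets_eqpoll_reals by (metis bij_betw_def eqpoll_def eqpoll_sym)
  have "\<Union>E = topspace X"
    using E(1) unfolding CW_structure_def by (elim conjE)
  then have "\<exists>e. e \<in> E \<and> x \<in> e" if "x \<in> topspace X" for x
    using that by blast
  then obtain cell where cell: "\<And>x. x \<in> topspace X \<Longrightarrow> cell x \<in> E \<and> x \<in> cell x"
    by metis
  define c where "c x = insert (to_nat_on E (cell x), 0)
      {(prod_encode (i, j), Suc 0) |i j. j \<in> b (k (cell x) x i)}" for x
  have "inj_on c (topspace X)"
  proof (rule inj_onI)
    fix x y assume xy: "x \<in> topspace X" "y \<in> topspace X" "c x = c y"
    have zero: "(m, 0) \<in> c z \<longleftrightarrow> m = to_nat_on E (cell z)" for m z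
      by (simp add: c_def)
    have "to_nat_on E (cell x) = to_nat_on E (cell y)"
      using zero [of "to_nat_on E (cell x)" x] zero [of "to_nat_on E (cell x)" y] xy(3) by simp
    then have eq: "cell x = cell y"
      using cell [OF xy(1)] cell [OF xy(2)] E(2) by simp
    have suc: "(prod_encode (i, j), Suc 0) \<in> c z \<longleftrightarrow> j \<in> b (k (cell z) z i)" for i j z
      by (auto simp: c_def)
    have "b (k (cell x) x i) = b (k (cell y) y i)" for i
      using suc [of i _ x] suc [of i _ y] xy(3) by (intro set_eqI) simp
    then have "k (cell x) x = k (cell x) y"
      using b eq by (intro ext) (simp add: inj_eq)
    then show "x = y"
      using inj_onD [OF k [of "cell x"]] cell [OF xy(1)] cell [OF xy(2)] eq by simp
  qed
  then show "topspace X \<lesssim> (UNIV :: real set)"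
    by (rule lepoll_real_if_inj)
qed

lemma abs_ext_homeomorphic_domain:
  assumes "Z homeomorphic_space Z'" and W: "abs_ext Z W"
  shows "abs_ext Z' W"
  unfolding abs_ext_def
proof (intro allI impI, elim conjE)
  fix A f assume A: "closedin Z' A" and f: "continuous_map (subtopology Z' A) W f"
  obtain h k where hk: "homeomorphic_maps Z Z' h k"
    using assms by (auto simp: homeomorphic_space_def)
  then have h: "continuous_map Z Z' h" and k: "continuous_map Z' Z k"
    and hk': "\<And>x. x \<in> topspace Z' \<Longrightarrow> h (k x) = x"
    by (auto simp: homeomorphic_maps_def)
  define B where "B = {z \<in> topspace Z. h z \<in> A}"
  have "closedin Z B"
    unfolding B_def using closedin_continuous_map_preimage [OF h A] .
  moreover have "continuous_map (subtopology Z B) (subtopology Z' A) h"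
    using h by (auto simp: continuous_map_in_subtopology continuous_map_from_subtopology B_def)
  then have "continuous_map (subtopology Z B) W (f \<circ> h)"
    using f continuous_map_compose by blast
  ultimately obtain g where g: "continuous_map Z W g" "\<And>x. x \<in> B \<Longrightarrow> g x = f (h x)"
    using W unfolding abs_ext_def by (metis comp_apply)
  have "continuous_map Z' W (g \<circ> k)"
    using g k continuous_map_compose by blast
  moreover have "(g \<circ> k) x = f x" if "x \<in> A" for x
  proof -
    have "x \<in> topspace Z'"
      using A that closedin_subset by blast
    moreover from this have "k x \<in> topspace Z"
      using k by (auto simp: continuous_map_def)
    ultimately show ?thesis
      using that by (simp add: g B_def hk')
  qed
  ultimately show "\<exists>g. continuous_map Z' W g \<and> (\<forall>x\<in>A. g x = f x)"
    by blast
qed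

lemma abs_ext_homeomorphic_codomain:
  assumes "W homeomorphic_space W'" and W: "abs_ext Z W"
  shows "abs_ext Z W'"
  unfolding abs_ext_def
proof (intro allI impI, elim conjE)
  fix A f assume A: "closedin Z A" and f: "continuous_map (subtopology Z A) W' f"
  obtain h k where hk: "homeomorphic_maps W W' h k"
    using assms by (auto simp: homeomorphic_space_def)
  then have h: "continuous_map W W' h" and k: "continuous_map W' W k"
    and hk': "\<And>x. x \<in> topspace W' \<Longrightarrow> h (k x) = x"
    by (auto simp: homeomorphic_maps_def)
  have "continuous_map (subtopology Z A) W (k \<circ> f)"
    using f k continuous_map_compose by blast
  then obtain g where g: "continuous_map Z W g" "\<And>x. x \<in> A \<Longrightarrow> g x = k (f x)"
    using A W unfolding abs_ext_def by (metis comp_apply)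
  have "f x \<in> topspace W'" if "x \<in> A" for x
    using f that closedin_subset [OF A] by (auto simp: continuous_map_def)
  then have "(h \<circ> g) x = f x" if "x \<in> A" for x
    using that by (simp add: g hk')
  moreover have "continuous_map Z W' (h \<circ> g)"
    using g h continuous_map_compose by blast
  ultimately show "\<exists>g. continuous_map Z W' g \<and> (\<forall>x\<in>A. g x = f x)"
    by blast
qed

lemma ext_leD:
  fixes Z :: "'z topology"
  assumes "ext_le L K" "polish Z" "abs_ext Z L"
  shows "abs_ext Z K"
proof -
  obtain Z' :: "real topology" where Z': "Z homeomorphic_space Z'" "polish Z'"
    using polish_real_copy assms by blast
  then have "abs_ext Z' K"
    using assms abs_ext_homeomorphic_domain unfolding ext_le_def by blast
  then show ?thesis
    using Z' abs_ext_homeomorphic_domain homeomorphic_space_sym by blast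
qed

lemma homotopic_with_conjugate:
  assumes "continuous_map X X' h" "continuous_map X' X k"
    and "homotopic_with (\<lambda>_. True) X X f id" "\<And>x. x \<in> topspace X' \<Longrightarrow> h (k x) = x"
  shows "homotopic_with (\<lambda>_. True) X' X' (h \<circ> f \<circ> k) id"
proof -
  have "homotopic_with (\<lambda>_. True) X' X' (h \<circ> f \<circ> k) (h \<circ> id \<circ> k)"
    using assms
    by (intro homotopic_with_compose_continuous_map_right [where p = "\<lambda>_. True"]
              homotopic_with_compose_continuous_map_left [where p = "\<lambda>_. True"]) auto
  then show ?thesis
    by (rule homotopic_with_eq) (use assms in auto)
qed

lemma CW_structure_homeomorphic:
  assumes hk: "homeomorphic_maps X X' h k" and E: "CW_structure X E dm"
  shows "CW_structure X' ((`) h ` E) (\<lambda>e. dm (k ` e))"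
proof -
  have h: "continuous_map X X' h" and k: "continuous_map X' X k"
    and kh: "\<And>x. x \<in> topspace X \<Longrightarrow> k (h x) = x" and hk': "\<And>x. x \<in> topspace X' \<Longrightarrow> h (k x) = x"
    using hk by (auto simp: homeomorphic_maps_def)
  have hm: "homeomorphic_map X X' h" and km: "homeomorphic_map X' X k"
    using hk homeomorphic_maps_map by blast+
  have sub: "e \<subseteq> topspace X" if "e \<in> E" for e
    using E that unfolding CW_structure_def by blast
  have khe: "k ` h ` e = e" if "e \<subseteq> topspace X" for e
    using that kh by (force simp: image_image)
  have inj: "inj_on h (topspace X)"
    using hm homeomorphic_imp_injective_map by blast
  show ?thesis
    unfolding CW_structure_def
  proof (intro conjI ballI allI impI)
    show "Hausdorff_space X'"
      using E hk homeomorphic_Hausdorff_space [of X X']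
      unfolding CW_structure_def homeomorphic_space_def by metis
    have "disjnt (h ` e) (h ` e')" if "e \<in> E" "e' \<in> E" "e \<noteq> e'" for e e'
    proof -
      have "disjnt e e'"
        using E that unfolding CW_structure_def pairwise_def by blast
      then show ?thesis
        using inj_on_image_Int [OF inj sub [OF that(1)] sub [OF that(2)]] by (auto simp: disjnt_def)
    qed
    then show "pairwise disjnt ((`) h ` E)"
      by (auto simp: pairwise_def)
    have "\<Union>E = topspace X"
      using E unfolding CW_structure_def by blast
    then show "\<Union>((`) h ` E) = topspace X'"
      using homeomorphic_imp_surjective_map [OF hm] by (metis image_Union)
  next
    fix e' assume "e' \<in> (`) h ` E"
    then obtain e where e: "e \<in> E" "e' = h ` e" by blast
    then have ke: "k ` e' = e" using khe sub by blast
    have "\<exists>\<Phi>. continuous_map (disc (dm e)) X \<Phi> \<and>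
        homeomorphic_map (subtopology (disc (dm e)) (open_disc (dm e))) (subtopology X e) \<Phi> \<and>
        (\<exists>S. finite S \<and> S \<subseteq> E \<and> (\<forall>s\<in>S. dm s < dm e) \<and> \<Phi> ` disc_boundary (dm e) \<subseteq> \<Union>S)"
      using E e(1) unfolding CW_structure_def by (elim conjE bspec)
    then obtain \<Phi> S where \<Phi>: "continuous_map (disc (dm e)) X \<Phi>"
        "homeomorphic_map (subtopology (disc (dm e)) (open_disc (dm e))) (subtopology X e) \<Phi>"
        "finite S" "S \<subseteq> E" "\<forall>s\<in>S. dm s < dm e" "\<Phi> ` disc_boundary (dm e) \<subseteq> \<Union>S"
      by (elim exE conjE) (rule that)
    have he: "homeomorphic_map (subtopology X e) (subtopology X' e') h"
    proof (rule homeomorphic_map_subtopologies [OF hm])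
      show "h ` (topspace X \<inter> e) = topspace X' \<inter> e'"
        using e sub [OF e(1)] homeomorphic_imp_surjective_map [OF hm] by blast
    qed
    show "\<exists>\<Phi>. continuous_map (disc (dm (k ` e'))) X' \<Phi> \<and>
        homeomorphic_map (subtopology (disc (dm (k ` e'))) (open_disc (dm (k ` e')))) (subtopology X' e') \<Phi> \<and>
        (\<exists>S. finite S \<and> S \<subseteq> (`) h ` E \<and> (\<forall>s\<in>S. dm (k ` s) < dm (k ` e')) \<and>
             \<Phi> ` disc_boundary (dm (k ` e')) \<subseteq> \<Union>S)"
      unfolding ke
    proof (intro exI [of _ "h \<circ> \<Phi>"] exI [of _ "(`) h ` S"] conjI)
      show "continuous_map (disc (dm e)) X' (h \<circ> \<Phi>)"
        using \<Phi> h continuous_map_compose by blast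
      show "homeomorphic_map (subtopology (disc (dm e)) (open_disc (dm e))) (subtopology X' e') (h \<circ> \<Phi>)"
        using \<Phi> he homeomorphic_map_compose by blast
      show "\<forall>s\<in>(`) h ` S. dm (k ` s) < dm e"
      proof
        fix s assume "s \<in> (`) h ` S"
        then obtain t where "t \<in> S" "s = h ` t" by blast
        then show "dm (k ` s) < dm e"
          using khe [OF sub [of t]] \<Phi> by auto
      qed
      show "(h \<circ> \<Phi>) ` disc_boundary (dm e) \<subseteq> \<Union>((`) h ` S)"
        using \<Phi>(6) by auto
    qed (use \<Phi> in auto)
  next
    fix C assume C: "C \<subseteq> topspace X'" "\<forall>e'\<in>(`) h ` E. closedin X' (C \<inter> X' closure_of e')"
    have "closedin X (k ` C \<inter> X closure_of e)" if "e \<in> E" for e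
    proof -
      have "X' closure_of (h ` e) = h ` (X closure_of e)"
        using homeomorphic_map_closure_of [OF hm sub [OF that]] by simp
      moreover have "k ` (C \<inter> h ` (X closure_of e)) = k ` C \<inter> X closure_of e"
      proof -
        have "X closure_of e \<subseteq> topspace X"
          by (simp add: closure_of_subset_topspace)
        then show ?thesis
          using C(1) kh hk' by (safe; force simp: subset_iff)
      qed
      moreover have "closedin X (k ` (C \<inter> X' closure_of (h ` e)))"
        using C that homeomorphic_map_closedness_eq [OF km] by blast
      ultimately show ?thesis
        by simp
    qed
    moreover have "k ` C \<subseteq> topspace X"
      using C(1) homeomorphic_imp_surjective_map [OF km] by blast
    moreover have "\<forall>D. D \<subseteq> topspace X \<longrightarrow> (\<forall>e\<in>E. closedin X (D \<inter> X closure_of e)) \<longrightarrow> closedin X D"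
      using E unfolding CW_structure_def by (elim conjE)
    ultimately have "closedin X (k ` C)"
      by simp
    then show "closedin X' C"
      using C(1) homeomorphic_map_closedness_eq [OF km] by blast
  qed
qed

lemma cplx_real_copy:
  assumes "cplx L"
  shows "\<exists>L' :: real topology. L homeomorphic_space L' \<and> cplx L'"
proof -
  obtain L' :: "real topology" where L': "L homeomorphic_space L'"
    using assms countable_CW_real_copy unfolding cplx_def by blast
  then obtain h k where hk: "homeomorphic_maps L L' h k"
    by (auto simp: homeomorphic_space_def)
  then have h: "continuous_map L L' h" and k: "continuous_map L' L k"
    and hk': "\<And>x. x \<in> topspace L' \<Longrightarrow> h (k x) = x"
    by (auto simp: homeomorphic_maps_def)
  have "countable_CW L'"
    using assms CW_structure_homeomorphic [OF hk] unfolding cplx_def countable_CW_def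
    by (meson countable_image)
  moreover obtain P :: "real topology" and i r where P: "finite_CW P"
      "continuous_map L P i" "continuous_map P L r"
      "homotopic_with (\<lambda>_. True) L L (r \<circ> i) id"
    using assms unfolding cplx_def finitely_dominated_def by blast
  have "homotopic_with (\<lambda>_. True) L' L' ((h \<circ> r) \<circ> (i \<circ> k)) id"
    using homotopic_with_conjugate [OF h k P(4) hk'] by (simp add: o_assoc)
  then have "finitely_dominated L'"
    unfolding finitely_dominated_def using P h k continuous_map_compose by blast
  ultimately show ?thesis
    using L' unfolding cplx_def by blast
qed

lemma ed_le_iff:
  fixes Z :: "'z topology"
  assumes "polish Z" "cplx L"
  shows "ed_le Z L \<longleftrightarrow> abs_ext Z L"
proof
  assume "ed_le Z L"
  then obtain K :: "real topology" where "abs_ext Z K" "ext_le K L"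
    unfolding ed_le_def by blast
  then show "abs_ext Z L"
    using ext_leD assms(1) by blast
next
  assume Z: "abs_ext Z L"
  obtain K :: "real topology" where K: "L homeomorphic_space K" "cplx K"
    using cplx_real_copy assms by blast
  have "abs_ext Z K"
    using abs_ext_homeomorphic_codomain [OF K(1) Z] .
  moreover have "K homeomorphic_space L"
    using K(1) homeomorphic_space_sym by blast
  then have "ext_le K L"
    using abs_ext_homeomorphic_codomain unfolding ext_le_def by blast
  ultimately show "ed_le Z L"
    using K(2) unfolding ed_le_def by blast
qed

lemma ed_le_iff_least:
  fixes M :: "real topology"
  assumes "cplx M" "abs_ext Z M" "\<And>K :: real topology. cplx K \<Longrightarrow> abs_ext Z K \<Longrightarrow> ext_le M K"
  shows "ed_le Z L \<longleftrightarrow> ext_le M L"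
proof
  assume "ed_le Z L"
  then obtain K :: "real topology" where "cplx K" "abs_ext Z K" "ext_le K L"
    unfolding ed_le_def by blast
  with assms(3) [of K] show "ext_le M L"
    by (simp add: ext_le_def)
next
  assume "ext_le M L"
  with assms(1,2) show "ed_le Z L"
    unfolding ed_le_def by blast
qed

end

theory Submission
  imports Defs
begin

text \<open>
  The argument is E. Michael's construction for finite-dimensional domains: approximate selections
  are improved step by step, and a uniform limit of them is a selection. Two points differ from
  the classical proof.

  The hypotheses on the values only speak of extensions over spaces of extension dimension at most
  \<open>[L]\<close>, and the simplices of a nerve need not be such spaces. So nothing is built on a nerve.
  What is used is that \<open>X\<close> itself is such a space, so a map from a closed subset of \<open>X\<close> into a value
  extends over all of \<open>X\<close>. The role of the dimension bound \<open>[L] \<le> [S\<^sup>n]\<close> is that \<open>S\<^sup>n \<in> AE(X)\<close>, whence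
  every open cover of \<open>X\<close> is refined by a locally finite closed cover of order at most \<open>n + 1\<close>
  (\<open>finite_order_cover\<close>). The set of points lying in at least \<open>m\<close> members is closed, and these strata
  decrease from \<open>X\<close> to \<open>{}\<close> as \<open>m\<close> runs from \<open>1\<close> to \<open>n + 2\<close>. A function is defined on the strata by
  downward induction on \<open>m\<close>: two different intersections of \<open>m\<close> members meet only in the previous
  stratum, so the extensions over these intersections can be chosen independently
  (\<open>extend_along_strata\<close>). There are only \<open>n + 1\<close> steps, so the loss of precision is controlled.

  On one intersection the function to be extended is close to a single value \<open>T = F z\<close>, but it does not
  lie in \<open>T\<close>. The same induction, with values in \<open>T\<close> throughout, yields a continuous map into \<open>T\<close>
  close to it (\<open>push_into_member\<close>), and the equi-\<open>LC\<close> property extends that map over \<open>X\<close> with small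
  image. Old and new function disagree slightly where both are defined. A Banach space containing
  \<open>Y\<close> would allow a continuous correction. Here the two are superimposed instead, and the result
  is discontinuous, but only by jumps of the size of the error. Hence approximate selections are
  functions of small oscillation rather than continuous maps (\<open>osc_le\<close>). As the error tends to zero
  the oscillation does too, and the limit is continuous (\<open>selection_exists\<close>).

  Finally, the extension problem for \<open>f\<close> reduces to the existence of a selection: replacing
  \<open>F x\<close> by \<open>{f x}\<close> for \<open>x \<in> A\<close> keeps all hypotheses, and a selection of the new map extends \<open>f\<close>.
\<close>

section \<open>Closed covers of order at most \<open>n + 1\<close> from extension of maps into spheres\<close>

text \<open>
  Where the vector \<open>(g j x)\<^sub>j\<close> has norm \<open>r\<close> it defines a map into a sphere of radius \<open>r\<close>. Extending this
  map and using the extension wherever the norm is at most \<open>r\<close> removes the zeros, at a cost of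
  \<open>2 * r\<close> in every coordinate. The lower bound is uniform in \<open>x\<close>, so that later small
  perturbations cannot bring zeros back.
\<close>
lemma push_off_zero:
  fixes g :: "nat \<Rightarrow> 'a \<Rightarrow> real"
  assumes S: "abs_ext X (nsphere n)" and J: "finite J" "card J = Suc n"
    and g: "\<And>j. continuous_map X euclideanreal (g j)" and r: "0 < r"
  shows "\<exists>h. (\<forall>j. continuous_map X euclideanreal (h j)) \<and>
    (\<forall>j. \<forall>x\<in>topspace X. \<bar>h j x - g j x\<bar> \<le> 2 * r) \<and>
    (\<forall>x\<in>topspace X. \<exists>j\<in>J. r / Suc n \<le> \<bar>h j x\<bar>)"
proof -
  define p where "p x = (\<Sum>j\<in>J. (g j x)\<^sup>2)" for x
  have p: "continuous_map X euclideanreal p"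
    unfolding p_def by (intro continuous_map_sum continuous_map_real_pow g J)
  obtain e where e: "bij_betw e {..n} J"
    using J by (metis bij_betw_iff_card card_atMost finite_atMost)
  define D where "D = {x \<in> topspace X. p x = r\<^sup>2}"
  have D: "closedin X D"
    using closedin_continuous_map_preimage [OF p, of "{r\<^sup>2}"] by (simp add: D_def)
  define \<phi> where "\<phi> x i = (if i \<le> n then g (e i) x / r else 0)" for x i
  have sum_e: "(\<Sum>i\<le>n. F (e i)) = sum F J" for F :: "nat \<Rightarrow> real"
    using sum.reindex_bij_betw [OF e] .
  have unit: "(\<Sum>i\<le>n. (\<phi> x i)\<^sup>2) = p x / r\<^sup>2" for x
    using sum_e [of "\<lambda>j. (g j x)\<^sup>2"]
    by (simp add: \<phi>_def p_def power_divide flip: sum_divide_distrib)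
  have "continuous_map (subtopology X D) (nsphere n) \<phi>"
    unfolding nsphere continuous_map_in_subtopology continuous_map_componentwise_UNIV
  proof (intro conjI allI)
    fix i show "continuous_map (subtopology X D) euclideanreal (\<lambda>x. \<phi> x i)"
    proof (cases "i \<le> n")
      case True
      have "continuous_map X euclideanreal (\<lambda>x. g (e i) x * inverse r)"
        by (intro continuous_map_real_mult g) auto
      then show ?thesis
        using True by (simp add: \<phi>_def divide_inverse continuous_map_from_subtopology)
    qed (simp add: \<phi>_def)
  qed (use unit r in \<open>auto simp: D_def \<phi>_def\<close>)
  then obtain \<Phi> where \<Phi>: "continuous_map X (nsphere n) \<Phi>" "\<And>x. x \<in> D \<Longrightarrow> \<Phi> x = \<phi> x"
    using S D unfolding abs_ext_def by metis
  define k where "k = inv_into {..n} e"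
  have ek: "e (k j) = j" "k j \<le> n" if "j \<in> J" for j
    using that e bij_betw_inv_into_right [OF e that] bij_betwE [OF bij_betw_inv_into [OF e]]
    by (auto simp: k_def)
  have sumJ: "(\<Sum>j\<in>J. F (k j)) = (\<Sum>i\<le>n. F i)" for F :: "nat \<Rightarrow> real"
    unfolding k_def by (rule sum.reindex_bij_betw [OF bij_betw_inv_into [OF e]])
  define h where "h j x = (if j \<in> J then if p x \<le> r\<^sup>2 then r * \<Phi> x (k j) else g j x else g j x)" for j x
  have \<Phi>1: "(\<Sum>i\<le>n. (\<Phi> x i)\<^sup>2) = 1" if "x \<in> topspace X" for x
    using \<Phi>(1) that unfolding nsphere continuous_map_in_subtopology by auto
  show ?thesis
  proof (intro exI [of _ h] conjI allI ballI)
    fix j show "continuous_map X euclideanreal (h j)"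
    proof (cases "j \<in> J")
      case True
      have "continuous_map X euclideanreal (\<lambda>x. \<Phi> x (k j))"
        using continuous_map_compose [OF \<Phi>(1) continuous_map_nsphere_projection [of n "k j"]]
        by (simp add: o_def)
      then have "continuous_map X euclideanreal (\<lambda>x. r * \<Phi> x (k j))"
        by (intro continuous_map_real_mult) auto
      then have "continuous_map X euclideanreal (\<lambda>x. if p x \<le> r\<^sup>2 then r * \<Phi> x (k j) else g j x)"
        by (intro continuous_map_cases_le p continuous_map_from_subtopology g)
           (use \<Phi>(2) r ek [OF True] in \<open>auto simp: D_def \<phi>_def\<close>)
      moreover have "h j = (\<lambda>x. if p x \<le> r\<^sup>2 then r * \<Phi> x (k j) else g j x)"
        using True by (auto simp: h_def)
      ultimately show ?thesis by simp
    next
      case False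
      then have "h j = g j" by (auto simp: h_def)
      then show ?thesis using g by simp
    qed
  next
    fix j x assume x: "x \<in> topspace X"
    show "\<bar>h j x - g j x\<bar> \<le> 2 * r"
    proof (cases "j \<in> J \<and> p x \<le> r\<^sup>2")
      case True
      have "(g j x)\<^sup>2 \<le> p x"
        unfolding p_def by (rule member_le_sum) (use True J in auto)
      then have 1: "\<bar>g j x\<bar> \<le> r"
        using True r by (metis abs_le_square_iff abs_of_pos order_trans)
      have "(\<Phi> x (k j))\<^sup>2 \<le> (\<Sum>i\<le>n. (\<Phi> x i)\<^sup>2)"
        by (rule member_le_sum) (use True ek in auto)
      then have "\<bar>\<Phi> x (k j)\<bar> \<le> 1"
        using \<Phi>1 [OF x] by (simp add: abs_square_le_1)
      then have "\<bar>r * \<Phi> x (k j)\<bar> \<le> r"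
        using r by (simp add: abs_mult)
      then show ?thesis
        using 1 True by (simp add: h_def)
    next
      case False
      then have "h j x = g j x" by (auto simp: h_def)
      then show ?thesis using r by simp
    qed
  next
    fix x assume x: "x \<in> topspace X"
    have big: "r\<^sup>2 \<le> (\<Sum>j\<in>J. (h j x)\<^sup>2)"
    proof (cases "p x \<le> r\<^sup>2")
      case True
      then have "(\<Sum>j\<in>J. (h j x)\<^sup>2) = r\<^sup>2 * (\<Sum>j\<in>J. (\<Phi> x (k j))\<^sup>2)"
        by (simp add: h_def power_mult_distrib sum_distrib_left)
      then show ?thesis
        using sumJ [of "\<lambda>i. (\<Phi> x i)\<^sup>2"] \<Phi>1 [OF x] by simp
    next
      case False
      then show ?thesis by (simp add: h_def p_def)
    qed
    show "\<exists>j\<in>J. r / Suc n \<le> \<bar>h j x\<bar>"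
    proof (rule ccontr)
      assume "\<not> ?thesis"
      then have "\<bar>h j x\<bar> < r / Suc n" if "j \<in> J" for j using that by force
      then have "(h j x)\<^sup>2 < (r / Suc n)\<^sup>2" if "j \<in> J" for j
        using that r by (metis abs_ge_zero power2_abs power_strict_mono zero_less_numeral)
      then have "(\<Sum>j\<in>J. (h j x)\<^sup>2) < (\<Sum>j\<in>J. (r / Suc n)\<^sup>2)"
        using J by (intro sum_strict_mono) auto
      also have "\<dots> = r\<^sup>2 / Suc n"
        using J by (simp add: power_divide power2_eq_square)
      also have "\<dots> \<le> r\<^sup>2"
        using r by (simp add: divide_le_eq mult_le_cancel_left1)
      finally show False using big by simp
    qed
  qed
qed

text \<open>
  The perturbation above is applied to all index sets of size \<open>n + 1\<close> one after the other.
  The radii decrease so fast that everything done after stage \<open>m\<close> is smaller than the lower bound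
  achieved at stage \<open>m\<close>.
\<close>
lemma general_position:
  fixes g :: "nat \<Rightarrow> 'a \<Rightarrow> real"
  assumes S: "abs_ext X (nsphere n)" and g: "\<And>j. continuous_map X euclideanreal (g j)"
  shows "\<exists>h. (\<forall>j. continuous_map X euclideanreal (h j)) \<and>
    (\<forall>j. \<forall>x\<in>topspace X. \<bar>h j x - g j x\<bar> < 1 / 2) \<and>
    (\<forall>J. finite J \<and> card J = Suc n \<longrightarrow> (\<forall>x\<in>topspace X. \<exists>j\<in>J. h j x \<noteq> 0))"
proof -
  \<comment> \<open>With this ratio the perturbations after stage \<open>m\<close> sum up to less than the lower bound \<open>r m / Suc n\<close> of that stage.\<close>
  define q where "q = 1 / (4 * real (Suc n))"
  define r where "r m = q ^ m / 8" for m
  \<comment> \<open>\<open>t m\<close> is the sum of the perturbations \<open>2 * r l\<close> over \<open>l \<ge> m\<close>.\<close>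
  define t where "t m = 2 * r m / (1 - q)" for m
  have q: "0 < q" "q \<le> 1 / 4" by (auto simp: q_def field_simps)
  have r0: "0 < r m" for m using q by (simp add: r_def)
  have tt: "t m - t (Suc m) = 2 * r m" for m
  proof -
    have "t (Suc m) = q * t m" by (simp add: t_def r_def)
    then have "t m - t (Suc m) = (1 - q) * t m" by (simp add: algebra_simps)
    then show ?thesis using q by (simp add: t_def)
  qed
  define \<J> where "\<J> = {J :: nat set. finite J \<and> card J = Suc n}"
  have \<J>: "countable \<J>"
    by (rule countable_subset [OF _ countable_Collect_finite]) (auto simp: \<J>_def)
  have "{..n} \<in> \<J>" by (simp add: \<J>_def)
  then have ne: "\<J> \<noteq> {}" by blast
  define J where "J = from_nat_into \<J>"
  have J: "finite (J m)" "card (J m) = Suc n" for m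
    using from_nat_into [OF ne, of m] by (auto simp: J_def \<J>_def)
  define cont where "cont G \<longleftrightarrow> (\<forall>j. continuous_map X euclideanreal (G j))" for G :: "nat \<Rightarrow> 'a \<Rightarrow> real"
  define step where "step m G H \<longleftrightarrow> (\<forall>j. \<forall>x\<in>topspace X. \<bar>H j x - G j x\<bar> \<le> 2 * r m) \<and>
      (\<forall>x\<in>topspace X. \<exists>j\<in>J m. r m / Suc n \<le> \<bar>H j x\<bar>)" for m and G H :: "nat \<Rightarrow> 'a \<Rightarrow> real"
  have "\<exists>G. \<forall>m. (cont (G m) \<and> (m = 0 \<longrightarrow> G m = g)) \<and> step m (G m) (G (Suc m))"
  proof (rule dependent_nat_choice [where P = "\<lambda>m G. cont G \<and> (m = 0 \<longrightarrow> G = g)" and Q = step])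
    show "\<exists>G. cont G \<and> (0 = (0::nat) \<longrightarrow> G = g)" using g by (auto simp: cont_def)
    fix G m assume "cont G \<and> (m = (0::nat) \<longrightarrow> G = g)"
    then have G: "\<And>j. continuous_map X euclideanreal (G j)" by (simp add: cont_def)
    show "\<exists>H. (cont H \<and> (Suc m = 0 \<longrightarrow> H = g)) \<and> step m G H"
      using push_off_zero [OF S J [of m] G r0 [of m]] unfolding cont_def step_def by simp
  qed
  then obtain G where G: "\<And>m. cont (G m)" "G 0 = g" "\<And>m. step m (G m) (G (Suc m))"
    by metis
  have tail: "\<bar>G (m + l) j x - G m j x\<bar> \<le> t m - t (m + l)" if "x \<in> topspace X" for m l j x
  proof (induction l)
    case (Suc l)
    have "\<bar>G (Suc (m + l)) j x - G (m + l) j x\<bar> \<le> 2 * r (m + l)"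
      using G(3) that unfolding step_def by blast
    with Suc tt [of "m + l"] show ?case by simp
  qed simp
  have t0: "0 < t m" for m
    using r0 [of m] q by (simp add: t_def)
  have le: "\<bar>G l j x - G m j x\<bar> \<le> t m" if "x \<in> topspace X" "m \<le> l" for m l j x
    using tail [OF that(1), of m "l - m" j] that(2) t0 [of l] by simp
  have t: "t \<longlonglongrightarrow> 0"
  proof -
    have "(\<lambda>m. q ^ m * (1 / (4 * (1 - q)))) \<longlonglongrightarrow> 0 * (1 / (4 * (1 - q)))"
      by (intro tendsto_mult LIMSEQ_realpow_zero tendsto_const) (use q in auto)
    moreover have "t = (\<lambda>m. q ^ m * (1 / (4 * (1 - q))))"
      by (auto simp: t_def r_def)
    ultimately show ?thesis by simp
  qed
  have conv: "convergent (\<lambda>m. G m j x)" if "x \<in> topspace X" for j x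
  proof (rule Cauchy_convergent, rule metric_CauchyI)
    fix e :: real assume "0 < e"
    then obtain M where M: "t M < e / 2"
      using t [THEN order_tendstoD(2), of "e / 2"] by (auto simp: eventually_sequentially)
    have "dist (G k j x) (G l j x) < e" if "M \<le> k" "M \<le> l" for k l
      using le [OF \<open>x \<in> topspace X\<close> that(1), of j] le [OF \<open>x \<in> topspace X\<close> that(2), of j] M
      by (simp add: dist_real_def)
    then show "\<exists>M. \<forall>k\<ge>M. \<forall>l\<ge>M. dist (G k j x) (G l j x) < e" by blast
  qed
  define h where "h j x = lim (\<lambda>m. G m j x)" for j x
  have h: "\<bar>h j x - G m j x\<bar> \<le> t m" if "x \<in> topspace X" for j x m
  proof (rule LIMSEQ_le_const2)
    show "(\<lambda>l. \<bar>G l j x - G m j x\<bar>) \<longlonglongrightarrow> \<bar>h j x - G m j x\<bar>"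
      using conv [OF that, of j] unfolding h_def convergent_LIMSEQ_iff
      by (intro tendsto_intros) auto
    show "\<exists>N. \<forall>l\<ge>N. \<bar>G l j x - G m j x\<bar> \<le> t m"
      using le [OF that] by blast
  qed
  show ?thesis
  proof (intro exI [of _ h] conjI allI impI ballI)
    fix j
    have "continuous_map X Met_TC.mtopology (h j)"
    proof (rule Met_TC.continuous_map_uniform_limit [where F = sequentially and f = "\<lambda>m. G m j"])
      show "\<forall>\<^sub>F m in sequentially. continuous_map X Met_TC.mtopology (G m j)"
        using G(1) by (simp add: cont_def)
      fix e :: real assume "0 < e"
      then have "\<forall>\<^sub>F m in sequentially. t m < e"
        using t by (intro order_tendstoD(2)) auto
      then show "\<forall>\<^sub>F m in sequentially. \<forall>x\<in>topspace X. h j x \<in> UNIV \<and> dist (G m j x) (h j x) < e"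
      proof eventually_elim
        case (elim m)
        then show ?case using h [of _ j m] by (fastforce simp: dist_real_def abs_minus_commute)
      qed
    qed simp
    then show "continuous_map X euclideanreal (h j)" by simp
  next
    fix j x assume x: "x \<in> topspace X"
    have "t 0 < 1 / 2" using q by (simp add: t_def r_def field_simps)
    then show "\<bar>h j x - g j x\<bar> < 1 / 2" using h [OF x, of j 0] G(2) by simp
  next
    fix K :: "nat set" and x assume K: "finite K \<and> card K = Suc n" and x: "x \<in> topspace X"
    then obtain m where m: "J m = K"
      using from_nat_into_surj [OF \<J>, of K] by (auto simp: J_def \<J>_def)
    then obtain j where j: "j \<in> K" "r m / Suc n \<le> \<bar>G (Suc m) j x\<bar>"
      using G(3) [of m] x unfolding step_def by blast
    have "t (Suc m) < r m / Suc n"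
    proof -
      have "t (Suc m) = r m * (2 * q / (1 - q))" by (simp add: t_def r_def)
      also have "2 * q / (1 - q) = 2 / (4 * real (Suc n) - 1)"
      proof -
        have "2 * (1 / c) / (1 - 1 / c) = 2 / (c - 1)" if "1 < c" for c :: real
          using that by (simp add: divide_simps)
        from this [of "4 * real (Suc n)"] show ?thesis by (simp add: q_def)
      qed
      also have "r m * \<dots> < r m * (1 / Suc n)"
        by (rule mult_strict_left_mono [OF _ r0]) (simp add: field_simps)
      finally show ?thesis by simp
    qed
    then show "\<exists>j\<in>K. h j x \<noteq> 0"
      using j h [OF x, of j "Suc m"] by (intro bexI [of _ j]) auto
  qed
qed

text \<open>
  \<open>N x\<close> is the set of indices of the members of a closed cover that contain \<open>x\<close>; in these terms
  local finiteness and closedness become the second conclusion.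

  Countably many functions \<open>h j\<close> are taken such that \<open>h j\<close> is negative off the prescribed open
  set, the sets \<open>{h j > 0}\<close> cover, and no \<open>n + 1\<close> of the functions vanish together. The \<open>j\<close>-th
  member is \<open>{h j \<ge> 0}\<close> minus the earlier sets \<open>{h i > 0}\<close>. If \<open>x\<close> is in several members, then
  \<open>h j x = 0\<close> for each of them but the last, so there are at most \<open>n + 1\<close>.
\<close>
lemma finite_order_cover:
  assumes S: "abs_ext X (nsphere n)" and reg: "completely_regular_space X"
    and lin: "Lindelof_space X" and U: "\<And>x. x \<in> topspace X \<Longrightarrow> openin X (U x) \<and> x \<in> U x"
  obtains N :: "'a \<Rightarrow> nat set"
  where "\<And>x. x \<in> topspace X \<Longrightarrow> finite (N x) \<and> N x \<noteq> {} \<and> card (N x) \<le> Suc n"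
    and "\<And>x. x \<in> topspace X \<Longrightarrow> \<exists>V. openin X V \<and> x \<in> V \<and> (\<forall>z\<in>V. N z \<subseteq> N x)"
    and "\<And>x j. x \<in> topspace X \<Longrightarrow> j \<in> N x \<Longrightarrow>
           \<exists>a\<in>topspace X. \<forall>z\<in>topspace X. j \<in> N z \<longrightarrow> z \<in> U a"
proof (cases "topspace X = {}")
  case True
  then show thesis using that [of "\<lambda>_. {}"] by simp
next
  case False
  have "\<exists>b. continuous_map X euclideanreal b \<and> b x = 1 \<and> b ` (topspace X - U x) \<subseteq> {-1}"
    if "x \<in> topspace X" for x
    using reg completely_regular_space_gen_alt' [of "1::real" "-1" X] U [OF that] by auto
  then have "\<exists>b. \<forall>x\<in>topspace X. continuous_map X euclideanreal (b x) \<and> b x x = 1 \<and>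
      b x ` (topspace X - U x) \<subseteq> {-1}"
    by (intro bchoice) blast
  then obtain b where b': "\<forall>x\<in>topspace X. continuous_map X euclideanreal (b x) \<and> b x x = 1 \<and>
      b x ` (topspace X - U x) \<subseteq> {-1}" ..
  have b: "continuous_map X euclideanreal (b x)" "b x x = (1::real)"
      "\<And>z. z \<in> topspace X \<Longrightarrow> z \<notin> U x \<Longrightarrow> b x z = -1" if "x \<in> topspace X" for x
    using b' that by blast+
  define W where "W x = {z \<in> topspace X. b x z \<in> {1/2<..}}" for x
  have W: "openin X (W x)" "x \<in> W x" if "x \<in> topspace X" for x
    unfolding W_def
    using openin_continuous_map_preimage [OF b(1) [OF that], of "{1/2<..}"] b(2) [OF that] that by auto
  obtain \<V> where \<V>: "countable \<V>" "\<V> \<subseteq> W ` topspace X" "\<Union>\<V> = topspace X"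
  proof -
    have "\<Union>(W ` topspace X) = topspace X" using W by (auto simp: W_def)
    then have "\<exists>\<V>. countable \<V> \<and> \<V> \<subseteq> W ` topspace X \<and> \<Union>\<V> = topspace X"
      using W by (intro Lindelof_spaceD [OF lin]) auto
    then show ?thesis using that by (elim exE conjE)
  qed
  then obtain P where P: "countable P" "P \<subseteq> topspace X" "\<V> = W ` P"
    using countable_subset_image [of \<V> W "topspace X"] by blast
  have ne: "P \<noteq> {}"
  proof
    assume "P = {}"
    then show False using \<V>(3) P(3) \<open>topspace X \<noteq> {}\<close> by simp
  qed
  define a where "a = from_nat_into P"
  have a: "a j \<in> topspace X" for j
    unfolding a_def by (rule subsetD [OF P(2) from_nat_into [OF ne]])
  have cov: "\<exists>j. x \<in> W (a j)" if "x \<in> topspace X" for x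
  proof -
    have "x \<in> \<Union>(W ` P)" using that \<V>(3) unfolding P(3) by simp
    then obtain p where "p \<in> P" "x \<in> W p" by blast
    then show ?thesis using from_nat_into_surj [OF P(1), of p] unfolding a_def by metis
  qed
  obtain h where h: "\<forall>j. continuous_map X euclideanreal (h j)"
      "\<forall>j. \<forall>x\<in>topspace X. \<bar>h j x - b (a j) x\<bar> < 1 / 2"
      "\<forall>J. finite J \<and> card J = Suc n \<longrightarrow> (\<forall>x\<in>topspace X. \<exists>j\<in>J. h j x \<noteq> (0::real))"
    using general_position [OF S, of "\<lambda>j. b (a j)", OF b(1) [OF a]] by (elim exE conjE) (rule that)
  have hc: "continuous_map X euclideanreal (h j)" for j
    using h(1) by blast
  have hb: "\<bar>h j x - b (a j) x\<bar> < 1 / 2" if "x \<in> topspace X" for j x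
    using h(2) that by blast
  define N where "N x = {j. 0 \<le> h j x \<and> (\<forall>i<j. h i x \<le> 0)}" for x
  have pos: "\<exists>j. 0 < h j x" if x: "x \<in> topspace X" for x
  proof -
    obtain j where "1 / 2 < b (a j) x" using cov [OF x] by (auto simp: W_def)
    then show ?thesis using hb [OF x, of j] by (intro exI [of _ j]) linarith
  qed
  \<comment> \<open>The first positive function bounds \<open>N\<close> near \<open>x\<close>, which gives finiteness.\<close>
  define k where "k x = (LEAST j. 0 < h j x)" for x
  have k: "0 < h (k x) x" if x: "x \<in> topspace X" for x
    unfolding k_def by (rule LeastI_ex [OF pos [OF x]])
  have k_le: "h i x \<le> 0" if "i < k x" for i x
    using not_less_Least [OF that [unfolded k_def]] by simp
  have bound: "N z \<subseteq> {..i}" if "0 < h i z" for i z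
  proof
    fix j assume "j \<in> N z"
    then have "i < j \<Longrightarrow> h i z \<le> 0" by (simp add: N_def)
    then show "j \<in> {..i}" using that by fastforce
  qed
  show thesis
  proof (rule that [of N])
    fix x assume x: "x \<in> topspace X"
    have fin: "finite (N x)" using bound [OF k [OF x]] finite_subset by blast
    moreover have "k x \<in> N x" using k [OF x] k_le [of _ x] by (auto simp: N_def)
    moreover have "card (N x) \<le> Suc n"
    proof (rule ccontr)
      assume "\<not> ?thesis"
      then have "Suc n \<le> card (N x - {k x})" using fin \<open>k x \<in> N x\<close> by simp
      then obtain J where J: "J \<subseteq> N x - {k x}" "card J = Suc n" "finite J"
        by (meson obtain_subset_with_card_n)
      then obtain j where j: "j \<in> J" "h j x \<noteq> 0" using h(3) x by blast
      have "j \<in> N x" "j \<noteq> k x" using j(1) J(1) by auto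
      then have "j < k x" using bound [OF k [OF x]] by fastforce
      then show False using k_le [of j x] j(2) \<open>j \<in> N x\<close> by (simp add: N_def)
    qed
    ultimately show "finite (N x) \<and> N x \<noteq> {} \<and> card (N x) \<le> Suc n" by blast
    have "\<exists>V. openin X V \<and> x \<in> V \<and> (\<forall>z\<in>V. j \<notin> N z)" if j: "j \<notin> N x" for j
    proof -
      consider "h j x < 0" | i where "i < j" "0 < h i x" using j by (auto simp: N_def not_le)
      then show ?thesis
      proof cases
        case 1
        then show ?thesis
          using openin_continuous_map_preimage [OF hc, of "{..<0}" j] x
          by (intro exI [of _ "{z \<in> topspace X. h j z \<in> {..<0}}"]) (auto simp: N_def)
      next
        case 2
        then show ?thesis
          using openin_continuous_map_preimage [OF hc, of "{0<..}" i] x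
          by (intro exI [of _ "{z \<in> topspace X. h i z \<in> {0<..}}"]) (auto simp: N_def not_le)
      qed
    qed
    then obtain V where V: "\<And>j. j \<notin> N x \<Longrightarrow> openin X (V j) \<and> x \<in> V j \<and> (\<forall>z\<in>V j. j \<notin> N z)"
      by metis
    define O' where "O' = {z \<in> topspace X. h (k x) z \<in> {0<..}}"
    have O': "openin X O'" "x \<in> O'" "\<And>z. z \<in> O' \<Longrightarrow> N z \<subseteq> {..k x}"
      using openin_continuous_map_preimage [OF hc, of "{0<..}" "k x"] x k [OF x] bound
      by (auto simp: O'_def)
    have "openin X (\<Inter>(insert O' (V ` ({..k x} - N x))))"
      using O'(1) V by (intro openin_Inter) blast+
    moreover have "x \<in> \<Inter>(insert O' (V ` ({..k x} - N x)))" using O'(2) V by blast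
    moreover have "N z \<subseteq> N x" if z: "z \<in> \<Inter>(insert O' (V ` ({..k x} - N x)))" for z
    proof
      fix j assume j: "j \<in> N z"
      have "j \<in> {..k x}" using O'(3) [of z] z j by blast
      then show "j \<in> N x" using V [of j] z j by blast
    qed
    ultimately show "\<exists>V. openin X V \<and> x \<in> V \<and> (\<forall>z\<in>V. N z \<subseteq> N x)"
      by blast
  next
    fix x j assume "x \<in> topspace X" "j \<in> N x"
    show "\<exists>a\<in>topspace X. \<forall>z\<in>topspace X. j \<in> N z \<longrightarrow> z \<in> U a"
    proof (intro bexI [OF _ a [of j]] ballI impI, rule ccontr)
      fix z assume z: "z \<in> topspace X" "j \<in> N z" "z \<notin> U (a j)"
      then show False using b(3) [OF a z(1), of j] hb [OF z(1), of j] by (auto simp: N_def)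
    qed
  qed
qed

section \<open>Functions of small oscillation\<close>

text \<open>
  The oscillation of \<open>u\<close> on \<open>D\<close>, measured against the value at the centre, is at most \<open>c\<close>. The
  strict bounds \<open>r > c\<close> make the case \<open>c = 0\<close> continuity.
\<close>
definition osc_le :: "'a topology \<Rightarrow> 'a set \<Rightarrow> real \<Rightarrow> ('a \<Rightarrow> 'b::metric_space) \<Rightarrow> bool" where
  "osc_le X D c u \<longleftrightarrow>
     (\<forall>x\<in>D. \<forall>r>c. \<exists>V. openin X V \<and> x \<in> V \<and> (\<forall>z\<in>V \<inter> D. dist (u z) (u x) < r))"

lemma osc_leD:
  assumes "osc_le X D c u" "x \<in> D" "c < r"
  obtains V where "openin X V" "x \<in> V" "\<And>z. z \<in> V \<Longrightarrow> z \<in> D \<Longrightarrow> dist (u z) (u x) < r"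
proof -
  have "\<exists>V. openin X V \<and> x \<in> V \<and> (\<forall>z\<in>V \<inter> D. dist (u z) (u x) < r)"
    using assms unfolding osc_le_def by simp
  then obtain V where V: "openin X V" "x \<in> V" "\<forall>z\<in>V \<inter> D. dist (u z) (u x) < r"
    by (elim exE conjE)
  show thesis
    by (rule that [OF V(1,2)]) (use V(3) in simp)
qed

lemma osc_le_subset:
  assumes u: "osc_le X D c u" and sub: "D' \<subseteq> D"
  shows "osc_le X D' c u"
  unfolding osc_le_def
proof (intro ballI allI impI)
  fix x r assume "x \<in> D'" "c < r"
  then have "\<exists>V. openin X V \<and> x \<in> V \<and> (\<forall>z\<in>V \<inter> D. dist (u z) (u x) < r)"
    using u subsetD [OF sub] unfolding osc_le_def by simp
  then obtain V where "openin X V" "x \<in> V" "\<forall>z\<in>V \<inter> D. dist (u z) (u x) < r"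
    by (elim exE conjE)
  then show "\<exists>V. openin X V \<and> x \<in> V \<and> (\<forall>z\<in>V \<inter> D'. dist (u z) (u x) < r)"
    using sub by (intro exI [of _ V]) auto
qed

lemma osc_le_mono: "osc_le X D c u \<Longrightarrow> c \<le> c' \<Longrightarrow> osc_le X D c' u"
  unfolding osc_le_def by (meson le_less_trans)

lemma osc_le_0_iff_continuous:
  assumes "D \<subseteq> topspace X"
  shows "osc_le X D 0 u \<longleftrightarrow> continuous_map (subtopology X D) euclidean u"
proof -
  have top: "topspace (subtopology X D) = D"
    using assms by auto
  have "continuous_map (subtopology X D) Met_TC.mtopology u \<longleftrightarrow>
      (\<forall>x\<in>D. \<forall>r>0. \<exists>V. openin (subtopology X D) V \<and> x \<in> V \<and> (\<forall>z\<in>V. dist (u x) (u z) < r))"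
    unfolding Met_TC.continuous_map_to_metric top by simp
  also have "\<dots> \<longleftrightarrow> osc_le X D 0 u"
    unfolding osc_le_def
  proof (intro ball_cong refl all_cong imp_cong)
    fix x and r :: real assume "x \<in> D"
    then show "(\<exists>V. openin (subtopology X D) V \<and> x \<in> V \<and> (\<forall>z\<in>V. dist (u x) (u z) < r)) \<longleftrightarrow>
        (\<exists>V. openin X V \<and> x \<in> V \<and> (\<forall>z\<in>V \<inter> D. dist (u z) (u x) < r))"
      by (auto simp: openin_subtopology dist_commute)
  qed
  finally show ?thesis by simp
qed

text \<open>
  Jumps can only occur at points of \<open>B\<close>, because \<open>B\<close> is closed, and there they have the size of
  the distance between the two functions.
\<close>
lemma osc_le_superimpose:
  assumes u: "osc_le X B c u" and h: "osc_le X C 0 h"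
    and B: "closedin X B" "B \<subseteq> C" and C: "C \<subseteq> topspace X" and near: "\<And>b. b \<in> B \<Longrightarrow> dist (h b) (u b) \<le> c'"
    and le: "0 \<le> c'" "c \<le> c'"
  shows "osc_le X C c' (\<lambda>x. if x \<in> B then u x else h x)"
  unfolding osc_le_def
proof (intro ballI allI impI)
  fix x r assume x: "x \<in> C" and r: "c' < r"
  then have "0 < r - c'" by simp
  then obtain V where V: "openin X V" "x \<in> V" "\<And>z. z \<in> V \<Longrightarrow> z \<in> C \<Longrightarrow> dist (h z) (h x) < r - c'"
    using osc_leD [OF h x] by metis
  show "\<exists>W. openin X W \<and> x \<in> W \<and>
      (\<forall>z\<in>W \<inter> C. dist (if z \<in> B then u z else h z) (if x \<in> B then u x else h x) < r)"
  proof (cases "x \<in> B")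
    case False
    have W: "openin X (V - B)" using V(1) B(1) by blast
    show ?thesis
    proof (intro exI [of _ "V - B"] conjI ballI W)
      fix z assume "z \<in> (V - B) \<inter> C"
      then have "dist (h z) (h x) < r" using V(3) [of z] le by fastforce
      then show "dist (if z \<in> B then u z else h z) (if x \<in> B then u x else h x) < r"
        using False \<open>z \<in> (V - B) \<inter> C\<close> by simp
    qed (use V False in auto)
  next
    case True
    obtain W where W: "openin X W" "x \<in> W" "\<And>z. z \<in> W \<Longrightarrow> z \<in> B \<Longrightarrow> dist (u z) (u x) < r"
      using osc_leD [OF u True, of r] le r by (metis order_le_less_trans)
    have VW: "openin X (V \<inter> W)" using V(1) W(1) by blast
    show ?thesis
    proof (intro exI [of _ "V \<inter> W"] conjI ballI VW)
      fix z assume z: "z \<in> V \<inter> W \<inter> C"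
      have "dist (h z) (u x) \<le> dist (h z) (h x) + dist (h x) (u x)" by (rule dist_triangle)
      then have "dist (h z) (u x) < r" using V(3) [of z] near [OF True] z by fastforce
      then show "dist (if z \<in> B then u z else h z) (if x \<in> B then u x else h x) < r"
        using W(3) [of z] z True by simp
    qed (use V W in auto)
  qed
qed

lemma dist_triangle_chain: "dist a d \<le> dist a b + dist b c + dist c d" for a :: "'a::metric_space"
  using dist_triangle [of a d b] dist_triangle [of b d c] by linarith

section \<open>Extension along the strata of a cover\<close>

text \<open>
  \<open>Q k x y\<close> says that \<open>y\<close> is an admissible value at \<open>x\<close> after \<open>k\<close> steps, and \<open>c k\<close> bounds the
  oscillation then. Step \<open>k\<close> passes from the points of multiplicity more than \<open>m = n + 1 - k\<close> to
  those of multiplicity at least \<open>m\<close>. For \<open>\<sigma>\<close> of size \<open>m\<close>, the points \<open>x\<close> with \<open>\<sigma> \<subseteq> N x\<close> that are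
  not yet treated satisfy \<open>N x = \<sigma>\<close>, so the extensions for different \<open>\<sigma>\<close> do not interfere.
  The hypothesis \<open>start\<close> is for those \<open>\<sigma>\<close> whose points have not been reached before: a value chosen
  at one of them serves as the initial data there.
\<close>
lemma extend_along_strata:
  fixes N :: "'a \<Rightarrow> nat set" and Q :: "nat \<Rightarrow> 'a \<Rightarrow> 'b::metric_space \<Rightarrow> bool"
  assumes t1: "t1_space X"
    and N: "\<And>x. x \<in> topspace X \<Longrightarrow> finite (N x) \<and> N x \<noteq> {} \<and> card (N x) \<le> Suc n"
    and usc: "\<And>x. x \<in> topspace X \<Longrightarrow> \<exists>V. openin X V \<and> x \<in> V \<and> (\<forall>z\<in>V. N z \<subseteq> N x)"
    and c: "\<And>k. k \<le> n \<Longrightarrow> 0 \<le> c k"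
    and start: "\<And>k x. k \<le> n \<Longrightarrow> x \<in> topspace X \<Longrightarrow> \<exists>y. Q k x y"
    and step: "\<And>k \<sigma> B u. k \<le> n \<Longrightarrow> \<sigma> \<noteq> {} \<Longrightarrow> closedin X B \<Longrightarrow> B \<noteq> {} \<Longrightarrow>
        (\<And>x. x \<in> B \<Longrightarrow> \<sigma> \<subseteq> N x) \<Longrightarrow> osc_le X B (c k) u \<Longrightarrow> (\<And>x. x \<in> B \<Longrightarrow> Q k x (u x)) \<Longrightarrow>
        \<exists>w. (\<forall>x\<in>B. w x = u x) \<and> osc_le X {x \<in> topspace X. \<sigma> \<subseteq> N x} (c (Suc k)) w \<and>
            (\<forall>x\<in>topspace X. \<sigma> \<subseteq> N x \<longrightarrow> Q (Suc k) x (w x))"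
  shows "\<exists>u. osc_le X (topspace X) (c (Suc n)) u \<and> (\<forall>x\<in>topspace X. Q (Suc n) x (u x))"
proof -
  define E where "E m = {x \<in> topspace X. m \<le> card (N x)}" for m
  \<comment> \<open>Multiplicity is upper semicontinuous, so conditions inherited by larger index sets are closed.\<close>
  have sub_closed: "closedin X {x \<in> topspace X. P (N x)}"
    if "\<And>S T. P S \<Longrightarrow> S \<subseteq> T \<Longrightarrow> finite T \<Longrightarrow> P T" for P
  proof -
    have "openin X {x \<in> topspace X. \<not> P (N x)}"
    proof (subst openin_subopen, intro ballI)
      fix x assume "x \<in> {x \<in> topspace X. \<not> P (N x)}"
      then have x: "x \<in> topspace X" "\<not> P (N x)" by auto
      obtain V where V: "openin X V" "x \<in> V" "\<And>z. z \<in> V \<Longrightarrow> N z \<subseteq> N x"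
        using usc [OF x(1)] by blast
      have "V \<subseteq> {x \<in> topspace X. \<not> P (N x)}"
      proof
        fix z assume z: "z \<in> V"
        then have "z \<in> topspace X" using V(1) openin_subset by blast
        moreover have "\<not> P (N z)" using that [of "N z" "N x"] V(3) [OF z] N [OF x(1)] x(2) by blast
        ultimately show "z \<in> {x \<in> topspace X. \<not> P (N x)}" by simp
      qed
      then show "\<exists>T. openin X T \<and> x \<in> T \<and> T \<subseteq> {x \<in> topspace X. \<not> P (N x)}"
        using V by blast
    qed
    moreover have "topspace X - {x \<in> topspace X. P (N x)} = {x \<in> topspace X. \<not> P (N x)}" by auto
    ultimately show ?thesis by (simp add: closedin_def)
  qed
  have strata: "k \<le> Suc n \<Longrightarrow>
      \<exists>u. osc_le X (E (Suc (Suc n) - k)) (c k) u \<and> (\<forall>x\<in>E (Suc (Suc n) - k). Q k x (u x))" for k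
  proof (induction k)
    case 0
    have "E (Suc (Suc n)) = {}" using N by (force simp: E_def)
    then show ?case by (simp add: osc_le_def)
  next
    case (Suc k)
    define m where "m = Suc n - k"
    have m: "Suc (Suc n) - k = Suc m" "Suc (Suc n) - Suc k = m" "m \<noteq> 0" "k \<le> n"
      using Suc.prems by (auto simp: m_def)
    obtain u where u: "osc_le X (E (Suc m)) (c k) u" "\<And>x. x \<in> E (Suc m) \<Longrightarrow> Q k x (u x)"
      using Suc.IH Suc.prems by (auto simp: m)
    define C where "C \<sigma> = {x \<in> topspace X. \<sigma> \<subseteq> N x}" for \<sigma>
    have "\<exists>w. (\<forall>x\<in>C \<sigma> \<inter> E (Suc m). w x = u x) \<and> osc_le X (C \<sigma>) (c (Suc k)) w \<and>
        (\<forall>x\<in>C \<sigma>. Q (Suc k) x (w x))" if \<sigma>: "\<sigma> \<noteq> {}" for \<sigma>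
    proof -
      define B where "B = C \<sigma> \<inter> E (Suc m)"
      have clB: "closedin X B"
      proof -
        have "closedin X {x \<in> topspace X. \<sigma> \<subseteq> N x \<and> Suc m \<le> card (N x)}"
          by (rule sub_closed) (meson card_mono order_trans)
        moreover have "B = {x \<in> topspace X. \<sigma> \<subseteq> N x \<and> Suc m \<le> card (N x)}"
          by (auto simp: B_def C_def E_def)
        ultimately show ?thesis by simp
      qed
      show ?thesis
      proof (cases "B = {}")
        case False
        have "\<exists>w. (\<forall>x\<in>B. w x = u x) \<and> osc_le X {x \<in> topspace X. \<sigma> \<subseteq> N x} (c (Suc k)) w \<and>
            (\<forall>x\<in>topspace X. \<sigma> \<subseteq> N x \<longrightarrow> Q (Suc k) x (w x))"
        proof (rule step [OF m(4) \<sigma> clB False])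
          show "osc_le X B (c k) u" using osc_le_subset [OF u(1)] by (simp add: B_def)
        qed (use u(2) in \<open>auto simp: B_def C_def\<close>)
        then show ?thesis by (auto simp: B_def C_def)
      next
        case empty: True
        show ?thesis
        proof (cases "C \<sigma> = {}")
          case True
          then show ?thesis by (simp add: osc_le_def)
        next
          case False
          then obtain x0 where x0: "x0 \<in> topspace X" "\<sigma> \<subseteq> N x0" by (auto simp: C_def)
          obtain y where y: "Q k x0 y" using start [OF m(4) x0(1)] by blast
          have "\<exists>w. (\<forall>x\<in>{x0}. w x = y) \<and> osc_le X {x \<in> topspace X. \<sigma> \<subseteq> N x} (c (Suc k)) w \<and>
            (\<forall>x\<in>topspace X. \<sigma> \<subseteq> N x \<longrightarrow> Q (Suc k) x (w x))"
          proof (rule step [OF m(4) \<sigma>])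
            show "closedin X {x0}" using t1 x0(1) by (simp add: closedin_t1_singleton)
            show "osc_le X {x0} (c k) (\<lambda>x. y)"
              using x0(1) c [OF m(4)] by (auto simp: osc_le_def intro!: exI [of _ "topspace X"])
          qed (use x0 y in auto)
          then show ?thesis using empty by (auto simp: B_def C_def)
        qed
      qed
    qed
    then obtain w where w: "\<And>\<sigma> x. \<sigma> \<noteq> {} \<Longrightarrow> x \<in> C \<sigma> \<Longrightarrow> x \<in> E (Suc m) \<Longrightarrow> w \<sigma> x = u x"
        "\<And>\<sigma>. \<sigma> \<noteq> {} \<Longrightarrow> osc_le X (C \<sigma>) (c (Suc k)) (w \<sigma>)"
        "\<And>\<sigma> x. \<sigma> \<noteq> {} \<Longrightarrow> x \<in> C \<sigma> \<Longrightarrow> Q (Suc k) x (w \<sigma> x)"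
      by (metis IntI)
    \<comment> \<open>Off the previous stratum \<open>N x\<close> itself is the only index set of size \<open>m\<close> below \<open>N x\<close>.\<close>
    define v where "v x = (if x \<in> E (Suc m) then u x else w (N x) x)" for x
    have v: "v x = w \<sigma> x" if "x \<in> C \<sigma>" "card \<sigma> = m" for x \<sigma>
    proof (cases "x \<in> E (Suc m)")
      case True
      have "\<sigma> \<noteq> {}" using that(2) m(3) by auto
      then show ?thesis using w(1) [OF _ that(1) True] True by (simp add: v_def)
    next
      case False
      then have "card (N x) \<le> m" "x \<in> topspace X" "\<sigma> \<subseteq> N x" using that(1) by (auto simp: C_def E_def)
      then have "\<sigma> = N x"
        using that(2) N [of x] card_seteq [of "N x" \<sigma>] by blast
      then show ?thesis using False by (simp add: v_def)
    qed
    have ex: "\<exists>\<sigma>\<subseteq>N x. card \<sigma> = m" if "x \<in> E m" for x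
    proof -
      have "m \<le> card (N x)" using that by (simp add: E_def)
      then show ?thesis by (meson obtain_subset_with_card_n)
    qed
    have "osc_le X (E m) (c (Suc k)) v"
      unfolding osc_le_def
    proof (intro ballI allI impI)
      fix x r assume x: "x \<in> E m" and r: "c (Suc k) < r"
      then have xX: "x \<in> topspace X" by (simp add: E_def)
      obtain V where V: "openin X V" "x \<in> V" "\<And>z. z \<in> V \<Longrightarrow> N z \<subseteq> N x"
        using usc [OF xX] by blast
      define \<Sigma> where "\<Sigma> = {\<sigma>. \<sigma> \<subseteq> N x \<and> card \<sigma> = m}"
      have \<Sigma>: "finite \<Sigma>" using N [OF xX] by (simp add: \<Sigma>_def)
      have "\<exists>W. openin X W \<and> x \<in> W \<and> (\<forall>z\<in>W \<inter> C \<sigma>. dist (w \<sigma> z) (w \<sigma> x) < r)" if "\<sigma> \<in> \<Sigma>" for \<sigma>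
      proof -
        have "\<sigma> \<noteq> {}" "x \<in> C \<sigma>" using that m(3) xX by (auto simp: \<Sigma>_def C_def)
        then show ?thesis using w(2) [of \<sigma>] r unfolding osc_le_def by blast
      qed
      then obtain W where W: "\<And>\<sigma>. \<sigma> \<in> \<Sigma> \<Longrightarrow> openin X (W \<sigma>) \<and> x \<in> W \<sigma> \<and>
          (\<forall>z\<in>W \<sigma> \<inter> C \<sigma>. dist (w \<sigma> z) (w \<sigma> x) < r)"
        by metis
      have Wo: "openin X (W \<sigma>)" and Wx: "x \<in> W \<sigma>"
        and Wd: "z \<in> W \<sigma> \<Longrightarrow> z \<in> C \<sigma> \<Longrightarrow> dist (w \<sigma> z) (w \<sigma> x) < r" if "\<sigma> \<in> \<Sigma>" for \<sigma> z
        using W [OF that] by blast+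
      have op: "openin X (\<Inter>(insert V (W ` \<Sigma>)))"
        by (rule openin_Inter) (use V(1) Wo \<Sigma> in auto)
      show "\<exists>V. openin X V \<and> x \<in> V \<and> (\<forall>z\<in>V \<inter> E m. dist (v z) (v x) < r)"
      proof (intro exI [of _ "\<Inter>(insert V (W ` \<Sigma>))"] conjI ballI)
        show "openin X (\<Inter>(insert V (W ` \<Sigma>)))" by (fact op)
        show "x \<in> \<Inter>(insert V (W ` \<Sigma>))" using V(2) Wx by blast
        fix z assume z: "z \<in> \<Inter>(insert V (W ` \<Sigma>)) \<inter> E m"
        then obtain \<sigma> where \<sigma>: "\<sigma> \<subseteq> N z" "card \<sigma> = m" using ex by blast
        have "z \<in> V" "z \<in> topspace X" using z by (auto simp: E_def)
        then have "\<sigma> \<subseteq> N x" using V(3) \<sigma> by blast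
        then have "\<sigma> \<in> \<Sigma>" "x \<in> C \<sigma>" "z \<in> C \<sigma>"
          using \<sigma> xX \<open>z \<in> topspace X\<close> by (auto simp: \<Sigma>_def C_def)
        have "z \<in> W \<sigma>" using z \<open>\<sigma> \<in> \<Sigma>\<close> by blast
        then have "dist (w \<sigma> z) (w \<sigma> x) < r"
          using Wd [OF \<open>\<sigma> \<in> \<Sigma>\<close> _ \<open>z \<in> C \<sigma>\<close>] by blast
        then show "dist (v z) (v x) < r"
          unfolding v [OF \<open>x \<in> C \<sigma>\<close> \<sigma>(2)] v [OF \<open>z \<in> C \<sigma>\<close> \<sigma>(2)] .
      qed
    qed
    moreover have "Q (Suc k) x (v x)" if x: "x \<in> E m" for x
    proof -
      obtain \<sigma> where \<sigma>: "\<sigma> \<subseteq> N x" "card \<sigma> = m" using ex [OF x] by blast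
      then have "x \<in> C \<sigma>" "\<sigma> \<noteq> {}" using x m(3) by (auto simp: C_def E_def)
      then show ?thesis using w(3) v \<sigma>(2) by metis
    qed
    ultimately have "osc_le X (E m) (c (Suc k)) v \<and> (\<forall>x\<in>E m. Q (Suc k) x (v x))" by simp
    then show ?case unfolding m(2) by (rule exI [of _ v])
  qed
  have "Suc (Suc n) - Suc n = 1" by simp
  moreover have "E 1 = topspace X"
    using N by (auto simp: E_def Suc_le_eq card_gt_0_iff)
  ultimately show ?thesis
    using strata [of "Suc n"] by simp
qed

section \<open>Star refinements in metrizable spaces\<close>

text \<open>
  Balls \<open>B(x, r)\<close> whose radius is an eighth of a dyadic number \<open>2\<^sup>-\<^sup>m\<close>, with \<open>m\<close> minimal such that
  \<open>B(x, 2\<^sup>-\<^sup>m)\<close> is contained in a member. If another of these balls meets it, then by minimality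
  the exponent there is at least \<open>m - 1\<close>, and so \<open>B(x, 2\<^sup>-\<^sup>m)\<close> contains the whole star.
\<close>
lemma star_refinement:
  assumes X: "metrizable_space X" and \<U>: "\<And>U. U \<in> \<U> \<Longrightarrow> openin X U" "\<Union>\<U> = topspace X"
  shows "\<exists>\<V>. (\<forall>V\<in>\<V>. openin X V \<and> V \<noteq> {}) \<and> \<Union>\<V> = topspace X \<and>
    (\<forall>V\<in>\<V>. \<exists>U\<in>\<U>. \<forall>V'\<in>\<V>. V \<inter> V' \<noteq> {} \<longrightarrow> V' \<subseteq> U)"
proof -
  obtain M d where "Metric_space M d" and XM: "X = Metric_space.mtopology M d"
    using X unfolding metrizable_space_def by blast
  interpret Metric_space M d by fact
  define r where "r m = (1 / 2 :: real) ^ m" for m :: nat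
  have r: "0 < r m" "r (Suc m) = r m / 2" for m by (auto simp: r_def)
  have r_anti: "r m \<le> r l" if "l \<le> m" for l m
    using that by (simp add: r_def power_decreasing)
  define good where "good x m \<longleftrightarrow> (\<exists>U\<in>\<U>. mball x (r m) \<subseteq> U)" for x m
  have ex: "\<exists>m. good x m" if x: "x \<in> M" for x
  proof -
    obtain U where U: "U \<in> \<U>" "x \<in> U" using \<U>(2) x by (auto simp: XM)
    then obtain s where s: "0 < s" "mball x s \<subseteq> U"
      using \<U>(1) unfolding XM openin_mtopology by blast
    obtain m where m: "r m < s" using real_arch_pow_inv [OF s(1), of "1/2"] by (auto simp: r_def)
    have "mball x (r m) \<subseteq> U" using mball_subset_concentric [of "r m" s x] m s(2) by simp
    then show ?thesis using U(1) unfolding good_def by blast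
  qed
  define l where "l x = (LEAST m. good x m)" for x
  have l: "good x (l x)" if "x \<in> M" for x
    unfolding l_def by (rule LeastI_ex [OF ex [OF that]])
  have l_le: "l x \<le> m" if "good x m" for x m
    unfolding l_def using that by (rule Least_le)
  define s where "s x = r (l x) / 8" for x
  define \<V> where "\<V> = (\<lambda>x. mball x (s x)) ` M"
  have s0: "0 < s x" for x using r by (simp add: s_def)
  have star: "mball y (s y) \<subseteq> mball x (r (l x))"
    if x: "x \<in> M" and y: "y \<in> M" and meet: "mball x (s x) \<inter> mball y (s y) \<noteq> {}" for x y
  proof -
    obtain z where z: "z \<in> M" "d x z < s x" "d y z < s y" using meet by auto
    have dxy: "d x y < s x + s y"
      using triangle [OF x z(1) y] z(2,3) commute [of y z] by linarith
    have "s y \<le> 2 * s x"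
    proof (cases "l x \<le> l y")
      case True
      then show ?thesis using r_anti [OF True] r(1) [of "l x"] by (simp add: s_def)
    next
      case False
      then have "s x \<le> s y" using r_anti [of "l y" "l x"] by (simp add: s_def)
      then have le: "d y x + r (Suc (l y)) \<le> r (l y)"
        using dxy r(2) [of "l y"] r(1) [of "l y"] commute [of x y] unfolding s_def by linarith
      obtain U where U: "U \<in> \<U>" "mball y (r (l y)) \<subseteq> U" using l [OF y] by (auto simp: good_def)
      have "mball x (r (Suc (l y))) \<subseteq> mball y (r (l y))"
        by (rule mball_subset) (use le y commute [of x y] in auto)
      then have "good x (Suc (l y))" using U unfolding good_def by blast
      then have "l x \<le> Suc (l y)" by (rule l_le)
      then have "r (Suc (l y)) \<le> r (l x)" by (rule r_anti)
      then show ?thesis using r(2) [of "l y"] by (simp add: s_def)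
    qed
    then show ?thesis
      by (intro mball_subset) (use dxy x commute [of x y] r(1) [of "l x"] in \<open>auto simp: s_def\<close>)
  qed
  show ?thesis
  proof (intro exI [of _ \<V>] conjI ballI)
    fix V assume "V \<in> \<V>"
    then obtain x where x: "x \<in> M" "V = mball x (s x)" by (auto simp: \<V>_def)
    show "openin X V" by (simp add: x(2) XM)
    show "V \<noteq> {}" using x s0 by (auto simp: mball_eq_empty not_le)
    obtain U where U: "U \<in> \<U>" "mball x (r (l x)) \<subseteq> U" using l [OF x(1)] by (auto simp: good_def)
    show "\<exists>U\<in>\<U>. \<forall>V'\<in>\<V>. V \<inter> V' \<noteq> {} \<longrightarrow> V' \<subseteq> U"
    proof (intro bexI [OF _ U(1)] ballI impI)
      fix V' assume "V' \<in> \<V>" and meet: "V \<inter> V' \<noteq> {}"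
      then obtain y where y: "y \<in> M" "V' = mball y (s y)" by (auto simp: \<V>_def)
      show "V' \<subseteq> U" using star [OF x(1) y(1)] meet U(2) unfolding x(2) y(2) by blast
    qed
  next
    have "x \<in> mball x (s x)" if "x \<in> M" for x using that s0 by simp
    then show "\<Union>\<V> = topspace X" by (auto simp: \<V>_def XM)
  qed
qed

text \<open>
  Every member \<open>V\<close> obtains a centre \<open>z\<close>, such that \<open>U z\<close> contains the star of \<open>V\<close> in the new cover and
  \<open>z\<close> shares a member of the old cover with \<open>V\<close>. In a sequence of such covers, a centre chosen at a
  later stage therefore lies in the sets \<open>U z'\<close> of all centres \<open>z'\<close> chosen before it for the same
  points.
\<close>
lemma centred_refinement:
  assumes X: "metrizable_space X" and \<W>: "\<And>W. W \<in> \<W> \<Longrightarrow> openin X W" "\<Union>\<W> = topspace X"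
    and U: "\<And>z. z \<in> topspace X \<Longrightarrow> openin X (U z) \<and> z \<in> U z"
  shows "\<exists>\<V>. (\<forall>V\<in>\<V>. openin X V) \<and> \<Union>\<V> = topspace X \<and>
    (\<forall>V\<in>\<V>. \<exists>z\<in>topspace X. \<exists>W\<in>\<W>. z \<in> W \<and> V \<subseteq> W \<and> (\<forall>V'\<in>\<V>. V \<inter> V' \<noteq> {} \<longrightarrow> V' \<subseteq> U z))"
proof -
  define \<U> where "\<U> = {U z \<inter> W |z W. W \<in> \<W> \<and> z \<in> W}"
  have sub: "z \<in> topspace X" if "z \<in> W" "W \<in> \<W>" for z W
    using that \<W>(2) by blast
  have op: "openin X A" if "A \<in> \<U>" for A
    using that U sub \<W>(1) unfolding \<U>_def by blast
  have cov: "\<Union>\<U> = topspace X"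
  proof
    show "\<Union>\<U> \<subseteq> topspace X" using op openin_subset by blast
    show "topspace X \<subseteq> \<Union>\<U>"
    proof
      fix x assume x: "x \<in> topspace X"
      then obtain W where "W \<in> \<W>" "x \<in> W" using \<W>(2) by blast
      moreover have "x \<in> U x" using U [OF x] by blast
      ultimately show "x \<in> \<Union>\<U>" unfolding \<U>_def by blast
    qed
  qed
  have "\<exists>\<V>. (\<forall>V\<in>\<V>. openin X V \<and> V \<noteq> {}) \<and> \<Union>\<V> = topspace X \<and>
      (\<forall>V\<in>\<V>. \<exists>A\<in>\<U>. \<forall>V'\<in>\<V>. V \<inter> V' \<noteq> {} \<longrightarrow> V' \<subseteq> A)"
    by (rule star_refinement [OF X op cov])
  then obtain \<V> where \<V>: "\<forall>V\<in>\<V>. openin X V \<and> V \<noteq> {}" "\<Union>\<V> = topspace X"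
      "\<forall>V\<in>\<V>. \<exists>A\<in>\<U>. \<forall>V'\<in>\<V>. V \<inter> V' \<noteq> {} \<longrightarrow> V' \<subseteq> A"
    by (elim exE conjE) (rule that)
  show ?thesis
  proof (intro exI [of _ \<V>] conjI ballI)
    fix V assume V: "V \<in> \<V>"
    then obtain A where A: "A \<in> \<U>" "\<forall>V'\<in>\<V>. V \<inter> V' \<noteq> {} \<longrightarrow> V' \<subseteq> A" using \<V>(3) by blast
    from A(1) obtain z W where zW: "A = U z \<inter> W" "W \<in> \<W>" "z \<in> W" unfolding \<U>_def by blast
    have "V \<subseteq> A" using A(2) V \<V>(1) by blast
    then show "\<exists>z\<in>topspace X. \<exists>W\<in>\<W>. z \<in> W \<and> V \<subseteq> W \<and> (\<forall>V'\<in>\<V>. V \<inter> V' \<noteq> {} \<longrightarrow> V' \<subseteq> U z)"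
      using A(2) zW sub [OF zW(3,2)] by (intro bexI [of _ z] bexI [of _ W]) auto
  qed (use \<V> in auto)
qed

lemma refines_later:
  assumes "\<And>k V. V \<in> \<W> (Suc k) \<Longrightarrow> \<exists>W\<in>\<W> k. V \<subseteq> W" "k \<le> m" "V \<in> \<W> m"
  shows "\<exists>W\<in>\<W> k. V \<subseteq> W"
  using assms(2,3)
proof (induction m arbitrary: V rule: dec_induct)
  case base
  then show ?case by blast
next
  case (step m)
  then show ?case using assms(1) by (meson order_trans)
qed

section \<open>Control of extensions into a single value\<close>

text \<open>
  The equi-\<open>LC\<close> property for the domain \<open>X\<close> and one value \<open>T\<close>, with given bounds on the diameters of
  the images. For \<open>d\<close> and \<open>e\<close> not smaller than the diameter of \<open>T\<close> it says that \<open>T \<in> AE(X)\<close>.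
\<close>
definition controlled_ext :: "'a topology \<Rightarrow> 'b::metric_space set \<Rightarrow> real \<Rightarrow> real \<Rightarrow> bool" where
  "controlled_ext X T d e \<longleftrightarrow>
     (\<forall>B h. closedin X B \<and> continuous_map (subtopology X B) euclidean h \<and> h ` B \<subseteq> T \<and>
        (\<forall>b\<in>B. \<forall>b'\<in>B. dist (h b) (h b') \<le> d) \<longrightarrow>
        (\<exists>g. continuous_map X euclidean g \<and> g ` topspace X \<subseteq> T \<and> (\<forall>b\<in>B. g b = h b) \<and>
             (\<forall>x\<in>topspace X. \<forall>y\<in>topspace X. dist (g x) (g y) \<le> e)))"

lemma controlled_extD:
  assumes "controlled_ext X T d e" "closedin X B" "continuous_map (subtopology X B) euclidean h"
    and "\<And>b. b \<in> B \<Longrightarrow> h b \<in> T" "\<And>b b'. b \<in> B \<Longrightarrow> b' \<in> B \<Longrightarrow> dist (h b) (h b') \<le> d"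
  obtains g where "continuous_map X euclidean g" "\<And>x. x \<in> topspace X \<Longrightarrow> g x \<in> T"
    "\<And>b. b \<in> B \<Longrightarrow> g b = h b" "\<And>x y. x \<in> topspace X \<Longrightarrow> y \<in> topspace X \<Longrightarrow> dist (g x) (g y) \<le> e"
proof -
  have "\<exists>g. continuous_map X euclidean g \<and> g ` topspace X \<subseteq> T \<and> (\<forall>b\<in>B. g b = h b) \<and>
             (\<forall>x\<in>topspace X. \<forall>y\<in>topspace X. dist (g x) (g y) \<le> e)"
    using assms unfolding controlled_ext_def by (auto simp: image_subset_iff)
  then obtain g where g: "continuous_map X euclidean g" "g ` topspace X \<subseteq> T" "\<forall>b\<in>B. g b = h b"
             "\<forall>x\<in>topspace X. \<forall>y\<in>topspace X. dist (g x) (g y) \<le> e" by (elim exE conjE)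
  show thesis by (rule that [of g]) (use g in auto)
qed

lemma controlled_ext_mono:
  assumes c: "controlled_ext X T d e" and le: "d' \<le> d" "e \<le> e'"
  shows "controlled_ext X T d' e'"
  unfolding controlled_ext_def
proof (intro allI impI, elim conjE)
  fix B h assume B: "closedin X B" "continuous_map (subtopology X B) euclidean h" "h ` B \<subseteq> T"
    and d: "\<forall>b\<in>B. \<forall>b'\<in>B. dist (h b) (h b') \<le> d'"
  obtain g where g: "continuous_map X euclidean g" "\<And>x. x \<in> topspace X \<Longrightarrow> g x \<in> T"
      "\<And>b. b \<in> B \<Longrightarrow> g b = h b" "\<And>x y. x \<in> topspace X \<Longrightarrow> y \<in> topspace X \<Longrightarrow> dist (g x) (g y) \<le> e"
  proof (rule controlled_extD [OF c B(1,2)])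
    show "h b \<in> T" if "b \<in> B" for b using B(3) that by blast
    show "dist (h b) (h b') \<le> d" if "b \<in> B" "b' \<in> B" for b b'
      using d that le(1) order_trans by blast
  qed (rule that)
  have "dist (g x) (g y) \<le> e'" if "x \<in> topspace X" "y \<in> topspace X" for x y
    using g(4) [OF that] le(2) by linarith
  then show "\<exists>g. continuous_map X euclidean g \<and> g ` topspace X \<subseteq> T \<and> (\<forall>b\<in>B. g b = h b) \<and>
      (\<forall>x\<in>topspace X. \<forall>y\<in>topspace X. dist (g x) (g y) \<le> e')"
    using g(1-3) by (intro exI [of _ g]) auto
qed

lemma controlled_ext_singleton: "0 \<le> e \<Longrightarrow> controlled_ext X {y} d e"
  unfolding controlled_ext_def
  by (intro allI impI exI [of _ "\<lambda>_. y"]) auto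

lemma controlled_ext_abs_ext:
  assumes ext: "abs_ext X (top_of_set T)" and T: "\<And>p q. p \<in> T \<Longrightarrow> q \<in> T \<Longrightarrow> dist p q \<le> e"
  shows "controlled_ext X T d e"
  unfolding controlled_ext_def
proof (intro allI impI, elim conjE)
  fix B h assume B: "closedin X B" "continuous_map (subtopology X B) euclidean h" "h ` B \<subseteq> T"
  have "h \<in> topspace (subtopology X B) \<rightarrow> T" using B(3) by auto
  then have "continuous_map (subtopology X B) (top_of_set T) h"
    using B(2) by (simp add: continuous_map_in_subtopology image_subset_iff_funcset)
  then obtain g where g: "continuous_map X (top_of_set T) g" "\<forall>x\<in>B. g x = h x"
    using ext B(1) unfolding abs_ext_def by blast
  have "continuous_map X euclidean g" and gT: "g ` topspace X \<subseteq> T"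
    using g(1) by (auto simp: continuous_map_in_subtopology)
  moreover have "dist (g x) (g y) \<le> e" if "x \<in> topspace X" "y \<in> topspace X" for x y
    using gT that T by blast
  ultimately show "\<exists>g. continuous_map X euclidean g \<and> g ` topspace X \<subseteq> T \<and> (\<forall>b\<in>B. g b = h b) \<and>
      (\<forall>x\<in>topspace X. \<forall>y\<in>topspace X. dist (g x) (g y) \<le> e)"
    using g(2) by (intro exI [of _ g]) auto
qed

lemma diameter_leI:
  fixes S :: "'a::metric_space set"
  assumes "0 \<le> d" "\<And>x y. x \<in> S \<Longrightarrow> y \<in> S \<Longrightarrow> dist x y \<le> d"
  shows "diameter S \<le> d"
  using assms by (auto simp: diameter_def intro!: cSUP_least)

lemma controlled_ext_via_copy:
  fixes T :: "'b::metric_space set"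
  assumes hom: "X homeomorphic_space Z" and T: "bounded T" and a: "0 \<le> a" "a < \<delta>"
    and ext: "\<And>A f. closedin Z A \<Longrightarrow> continuous_map (subtopology Z A) (top_of_set T) f \<Longrightarrow>
        diameter (f ` A) < \<delta> \<Longrightarrow> \<exists>g. continuous_map Z (top_of_set T) g \<and> (\<forall>x\<in>A. g x = f x) \<and>
             diameter (g ` topspace Z) < e"
  shows "controlled_ext X T a e"
  unfolding controlled_ext_def
proof (intro allI impI, elim conjE)
  fix B h assume B: "closedin X B" "continuous_map (subtopology X B) euclidean h" "h ` B \<subseteq> T"
    and small: "\<forall>b\<in>B. \<forall>b'\<in>B. dist (h b) (h b') \<le> a"
  obtain \<phi> \<psi> where maps: "homeomorphic_maps X Z \<phi> \<psi>"
    using hom by (auto simp: homeomorphic_space_def)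
  then have \<phi>: "continuous_map X Z \<phi>" and \<psi>: "continuous_map Z X \<psi>"
    and \<psi>\<phi>: "\<And>x. x \<in> topspace X \<Longrightarrow> \<psi> (\<phi> x) = x"
    by (auto simp: homeomorphic_maps_def)
  have \<phi>Z: "\<phi> x \<in> topspace Z" if "x \<in> topspace X" for x
    using \<phi> that by (auto simp: continuous_map_def)
  define A where "A = {z \<in> topspace Z. \<psi> z \<in> B}"
  have A: "closedin Z A" unfolding A_def using closedin_continuous_map_preimage [OF \<psi> B(1)] .
  have "continuous_map (subtopology Z A) (subtopology X B) \<psi>"
    using \<psi> by (auto simp: continuous_map_in_subtopology continuous_map_from_subtopology A_def)
  then have "continuous_map (subtopology Z A) euclidean (h \<circ> \<psi>)"
    using B(2) continuous_map_compose by blast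
  then have "continuous_map (subtopology Z A) (top_of_set T) (h \<circ> \<psi>)"
    using B(3) by (auto simp: continuous_map_in_subtopology A_def)
  moreover have "diameter ((h \<circ> \<psi>) ` A) \<le> a"
    by (rule diameter_leI) (use a small in \<open>auto simp: A_def\<close>)
  then have "diameter ((h \<circ> \<psi>) ` A) < \<delta>" using a by simp
  ultimately obtain g where g: "continuous_map Z (top_of_set T) g" "\<forall>x\<in>A. g x = (h \<circ> \<psi>) x"
      "diameter (g ` topspace Z) < e"
    using ext [OF A, of "h \<circ> \<psi>"] by blast
  have gT: "g ` topspace Z \<subseteq> T" and gc: "continuous_map Z euclidean g"
    using g(1) by (auto simp: continuous_map_in_subtopology)
  have bdd: "bounded (g ` topspace Z)" using T gT bounded_subset by blast
  show "\<exists>g. continuous_map X euclidean g \<and> g ` topspace X \<subseteq> T \<and> (\<forall>b\<in>B. g b = h b) \<and>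
      (\<forall>x\<in>topspace X. \<forall>y\<in>topspace X. dist (g x) (g y) \<le> e)"
  proof (intro exI [of _ "g \<circ> \<phi>"] conjI ballI)
    show "continuous_map X euclidean (g \<circ> \<phi>)" using \<phi> gc continuous_map_compose by blast
    show "(g \<circ> \<phi>) ` topspace X \<subseteq> T" using gT \<phi>Z by auto
  next
    fix b assume b: "b \<in> B"
    then have "b \<in> topspace X" using closedin_subset [OF B(1)] by blast
    then have "\<phi> b \<in> A" "\<psi> (\<phi> b) = b" using b \<phi>Z \<psi>\<phi> by (auto simp: A_def)
    then show "(g \<circ> \<phi>) b = h b" using g(2) by simp
  next
    fix x y assume "x \<in> topspace X" "y \<in> topspace X"
    then have "dist (g (\<phi> x)) (g (\<phi> y)) \<le> diameter (g ` topspace Z)"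
      by (intro diameter_bounded_bound [OF bdd]) (use \<phi>Z in auto)
    then show "dist ((g \<circ> \<phi>) x) ((g \<circ> \<phi>) y) \<le> e" using g(3) by simp
  qed
qed

text \<open>
  Precisions are chosen from the last step back to the first.
\<close>
lemma descending_scales:
  fixes R :: "real \<Rightarrow> real \<Rightarrow> bool"
  assumes R: "\<And>b. 0 < b \<Longrightarrow> \<exists>a>0. R a b" and b: "0 < b"
  shows "\<exists>s. s N = b \<and> (\<forall>k\<le>N. 0 < s k) \<and> (\<forall>k<N. R (s k) (s (Suc k)))"
proof (induction N)
  case 0
  show ?case using b by (intro exI [of _ "\<lambda>_. b"]) auto
next
  case (Suc N)
  then obtain s where s: "s N = b" "\<forall>k\<le>N. 0 < s k" "\<forall>k<N. R (s k) (s (Suc k))" by blast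
  obtain a where a: "0 < a" "R a (s 0)" using R [of "s 0"] s(2) by blast
  have "R (case k of 0 \<Rightarrow> a | Suc i \<Rightarrow> s i) (s k)" if "k < Suc N" for k
    using that a s(3) by (cases k) auto
  then show ?case
    using s a by (intro exI [of _ "case_nat a s"]) (auto split: nat.split)
qed

text \<open>
  The precisions for the \<open>n + 1\<close> steps of the induction over the strata. In each of them the data to be
  extended are within \<open>e k\<close> of a given function and have diameter at most \<open>4 * e k\<close>; an extension of
  diameter at most \<open>e (Suc k) / 4\<close> then remains within \<open>e (Suc k)\<close> of the function.
\<close>
definition ladder :: "'a topology \<Rightarrow> nat \<Rightarrow> 'b::metric_space set set \<Rightarrow> (nat \<Rightarrow> real) \<Rightarrow> bool" where
  "ladder X n \<T> e \<longleftrightarrow> 0 < e 0 \<and>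
     (\<forall>k\<le>n. e k \<le> e (Suc k) / 4 \<and> (\<forall>T\<in>\<T>. controlled_ext X T (4 * e k) (e (Suc k) / 4)))"

lemma ladder_mono:
  assumes "ladder X n \<T> e" "k \<le> Suc n"
  shows "e 0 \<le> e k"
  using assms(2)
proof (induction k)
  case (Suc k)
  then have "e k \<le> e (Suc k) / 4" "e 0 \<le> e k" "0 < e 0" using assms(1) by (auto simp: ladder_def)
  then show ?case by linarith
qed simp

section \<open>Pushing a nearby function into a single value\<close>

lemma abs_ext_closed_subspace:
  assumes W: "abs_ext X W" and B: "closedin X B"
  shows "abs_ext (subtopology X B) W"
  unfolding abs_ext_def
proof (intro allI impI, elim conjE)
  fix A f assume A: "closedin (subtopology X B) A"
    and f: "continuous_map (subtopology (subtopology X B) A) W f"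
  have sub: "A \<subseteq> B" using closedin_subset [OF A] by auto
  then have eq: "subtopology (subtopology X B) A = subtopology X A"
    by (simp add: subtopology_subtopology Int_absorb1)
  have "closedin X A" using A B closedin_trans_full by blast
  then obtain g where "continuous_map X W g" "\<forall>x\<in>A. g x = f x"
    using W f unfolding eq abs_ext_def by blast
  then show "\<exists>g. continuous_map (subtopology X B) W g \<and> (\<forall>x\<in>A. g x = f x)"
    using continuous_map_from_subtopology by blast
qed

text \<open>
  A function \<open>u\<close> of small oscillation close to \<open>T\<close> is replaced by a continuous map into \<open>T\<close>, in the
  way a map into a locally \<open>n\<close>-connected space is built over a skeleton. The closed set \<open>B\<close> is covered
  by sets on which \<open>u\<close> is almost constant; over the strata of this cover the map is extended with values
  in \<open>T\<close> and stays close to \<open>u\<close>.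
\<close>
lemma push_into_member:
  fixes u :: "'a \<Rightarrow> 'b::metric_space"
  assumes X: "metrizable_space X" and lin: "Lindelof_space X" and S: "abs_ext X (nsphere n)"
    and e: "ladder X n {T} e" and B: "closedin X B" and u: "osc_le X B c u" and c: "c < e 0 / 2"
    and near: "\<And>b. b \<in> B \<Longrightarrow> \<exists>y\<in>T. dist y (u b) \<le> e 0"
  shows "\<exists>h. continuous_map (subtopology X B) euclidean h \<and> (\<forall>b\<in>B. h b \<in> T \<and> dist (h b) (u b) \<le> e (Suc n))"
proof -
  define Z where "Z = subtopology X B"
  have BX: "B \<subseteq> topspace X" using closedin_subset [OF B] .
  have tZ: "topspace Z = B" using BX by (auto simp: Z_def)
  have Z: "metrizable_space Z" "Lindelof_space Z" "abs_ext Z (nsphere n)"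
    unfolding Z_def using X lin S B
    by (simp_all add: metrizable_space_subtopology Lindelof_space_closedin_subtopology abs_ext_closed_subspace)
  have "\<exists>V. openin Z V \<and> a \<in> V \<and> (\<forall>z\<in>V. dist (u z) (u a) \<le> e 0 / 2)" if a: "a \<in> B" for a
  proof -
    obtain V where V: "openin X V" "a \<in> V" "\<And>z. z \<in> V \<Longrightarrow> z \<in> B \<Longrightarrow> dist (u z) (u a) < e 0 / 2"
      using osc_leD [OF u a c] by metis
    have "openin Z (V \<inter> B)" using V(1) by (auto simp: Z_def openin_subtopology)
    moreover have "\<forall>z\<in>V \<inter> B. dist (u z) (u a) \<le> e 0 / 2" using V(3) by (auto intro: less_imp_le)
    ultimately show ?thesis using a V(2) by blast
  qed
  then have "\<exists>U. \<forall>a\<in>B. openin Z (U a) \<and> a \<in> U a \<and> (\<forall>z\<in>U a. dist (u z) (u a) \<le> e 0 / 2)"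
    by (intro bchoice) blast
  then obtain U where U: "\<And>a. a \<in> B \<Longrightarrow> openin Z (U a) \<and> a \<in> U a"
      "\<And>a z. a \<in> B \<Longrightarrow> z \<in> U a \<Longrightarrow> dist (u z) (u a) \<le> e 0 / 2" by blast
  obtain N :: "'a \<Rightarrow> nat set" where N:
      "\<And>x. x \<in> topspace Z \<Longrightarrow> finite (N x) \<and> N x \<noteq> {} \<and> card (N x) \<le> Suc n"
      "\<And>x. x \<in> topspace Z \<Longrightarrow> \<exists>V. openin Z V \<and> x \<in> V \<and> (\<forall>z\<in>V. N z \<subseteq> N x)"
      "\<And>x j. x \<in> topspace Z \<Longrightarrow> j \<in> N x \<Longrightarrow> \<exists>a\<in>topspace Z. \<forall>z\<in>topspace Z. j \<in> N z \<longrightarrow> z \<in> U a"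
    using finite_order_cover [OF Z(3) metrizable_imp_completely_regular_space [OF Z(1)] Z(2), of U] U(1)
    unfolding tZ by blast
  define Q where "Q k x y \<longleftrightarrow> y \<in> T \<and> dist y (u x) \<le> e k" for k x y
  have "\<exists>h. osc_le Z (topspace Z) 0 h \<and> (\<forall>x\<in>topspace Z. Q (Suc n) x (h x))"
  proof (rule extend_along_strata [where c = "\<lambda>_. 0" and N = N])
    show "t1_space Z" using Z(1) metrizable_imp_t1_space by blast
    fix k x assume k: "k \<le> n" and x: "x \<in> topspace Z"
    then obtain y where "y \<in> T" "dist y (u x) \<le> e 0" using near tZ by blast
    then show "\<exists>y. Q k x y" using ladder_mono [OF e, of k] k unfolding Q_def by (intro exI [of _ y]) simp
  next
    fix k \<sigma> D v assume k: "k \<le> n" and \<sigma>: "\<sigma> \<noteq> {}" and D: "closedin Z D" "D \<noteq> {}"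
      and D\<sigma>: "\<And>x. x \<in> D \<Longrightarrow> \<sigma> \<subseteq> N x" and v: "osc_le Z D 0 v" "\<And>x. x \<in> D \<Longrightarrow> Q k x (v x)"
    have DB: "D \<subseteq> B" using closedin_subset [OF D(1)] tZ by simp
    obtain b where b: "b \<in> D" using D(2) by blast
    obtain j where j: "j \<in> \<sigma>" using \<sigma> by blast
    obtain a where a: "a \<in> B" "\<And>z. z \<in> B \<Longrightarrow> j \<in> N z \<Longrightarrow> z \<in> U a"
      using N(3) [of b j] D\<sigma> [OF b] j b DB unfolding tZ by blast
    have small: "dist (u x) (u y) \<le> e 0" if "x \<in> B" "\<sigma> \<subseteq> N x" "y \<in> B" "\<sigma> \<subseteq> N y" for x y
    proof -
      have "x \<in> U a" "y \<in> U a" using a(2) that j by blast+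
      then have "dist (u x) (u a) \<le> e 0 / 2" "dist (u y) (u a) \<le> e 0 / 2"
        using U(2) [OF a(1)] by blast+
      then show ?thesis using dist_triangle2 [of "u x" "u y" "u a"] by linarith
    qed
    have e0k: "e 0 \<le> e k" and ek: "e k \<le> e (Suc k) / 4" and "controlled_ext X T (4 * e k) (e (Suc k) / 4)"
      and e0: "0 < e 0"
      using e ladder_mono [OF e, of k] k by (auto simp: ladder_def)
    have vd: "dist (v x) (v y) \<le> 4 * e k" if "x \<in> D" "y \<in> D" for x y
    proof -
      have "dist (v x) (v y) \<le> dist (v x) (u x) + dist (u x) (u y) + dist (u y) (v y)"
        by (rule dist_triangle_chain)
      moreover have "dist (v x) (u x) \<le> e k" "dist (u y) (v y) \<le> e k"
        using v(2) that by (auto simp: Q_def dist_commute)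
      moreover have "dist (u x) (u y) \<le> e 0" using small D\<sigma> DB that by blast
      ultimately show ?thesis using e0 e0k by linarith
    qed
    have eq: "subtopology Z D = subtopology X D"
      using DB by (simp add: Z_def subtopology_subtopology Int_absorb1)
    have clD: "closedin X D" using D(1) B closedin_trans_full unfolding Z_def by blast
    have "continuous_map (subtopology X D) euclidean v"
      using v(1) osc_le_0_iff_continuous [of D Z v] DB tZ eq by simp
    then obtain w where w: "continuous_map X euclidean w" "\<And>x. x \<in> topspace X \<Longrightarrow> w x \<in> T"
      "\<And>b. b \<in> D \<Longrightarrow> w b = v b"
      "\<And>x y. x \<in> topspace X \<Longrightarrow> y \<in> topspace X \<Longrightarrow> dist (w x) (w y) \<le> e (Suc k) / 4"
      using controlled_extD [OF \<open>controlled_ext X T (4 * e k) (e (Suc k) / 4)\<close> clD, of v] v(2) vd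
      unfolding Q_def by blast
    show "\<exists>w. (\<forall>x\<in>D. w x = v x) \<and> osc_le Z {x \<in> topspace Z. \<sigma> \<subseteq> N x} 0 w \<and>
            (\<forall>x\<in>topspace Z. \<sigma> \<subseteq> N x \<longrightarrow> Q (Suc k) x (w x))"
    proof (intro exI [of _ w] conjI ballI impI)
      show "osc_le Z {x \<in> topspace Z. \<sigma> \<subseteq> N x} 0 w"
        using w(1) by (subst osc_le_0_iff_continuous) (auto simp: Z_def continuous_map_from_subtopology)
      fix x assume "x \<in> topspace Z" "\<sigma> \<subseteq> N x"
      then have x: "x \<in> B" "x \<in> topspace X" "\<sigma> \<subseteq> N x" using BX tZ by auto
      have "dist (w x) (u x) \<le> dist (w x) (w b) + dist (w b) (u b) + dist (u b) (u x)"
        by (rule dist_triangle_chain)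
      moreover have "dist (w x) (w b) \<le> e (Suc k) / 4" using w(4) x(2) b DB BX by blast
      moreover have "dist (w b) (u b) \<le> e k" using v(2) [OF b] w(3) [OF b] by (simp add: Q_def)
      moreover have "dist (u b) (u x) \<le> e 0" using small x b DB D\<sigma> by blast
      ultimately show "Q (Suc k) x (w x)"
        using w(2) [OF x(2)] e0k ek e0 unfolding Q_def by linarith
    qed (use w in auto)
  qed (use N in auto)
  then obtain h where h: "osc_le Z (topspace Z) 0 h" "\<forall>x\<in>topspace Z. Q (Suc n) x (h x)" by blast
  have "continuous_map Z euclidean h"
    using h(1) osc_le_0_iff_continuous [of "topspace Z" Z h] by simp
  moreover have "\<forall>b\<in>B. h b \<in> T \<and> dist (h b) (u b) \<le> e (Suc n)"
    using h(2) unfolding tZ Q_def .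
  ultimately show ?thesis unfolding Z_def by (intro exI [of _ h] conjI)
qed

text \<open>
  The conclusion of \<open>push_into_member\<close>, with the two tolerances of the input in one parameter.
\<close>
definition nearby_push :: "'a topology \<Rightarrow> 'b::metric_space set \<Rightarrow> real \<Rightarrow> real \<Rightarrow> bool" where
  "nearby_push X T a b \<longleftrightarrow>
     (\<forall>B u. closedin X B \<and> osc_le X B a u \<and> (\<forall>x\<in>B. \<exists>y\<in>T. dist y (u x) \<le> 2 * a) \<longrightarrow>
        (\<exists>h. continuous_map (subtopology X B) euclidean h \<and> (\<forall>x\<in>B. h x \<in> T \<and> dist (h x) (u x) \<le> b)))"

lemma nearby_push_antimono:
  assumes push: "nearby_push X T a b" and le: "a' \<le> a"
  shows "nearby_push X T a' b"
  unfolding nearby_push_def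
proof (intro allI impI, elim conjE)
  fix B u assume B: "closedin X B" "osc_le X B a' u" "\<forall>x\<in>B. \<exists>y\<in>T. dist y (u x) \<le> 2 * a'"
  have "osc_le X B a u" using osc_le_mono [OF B(2) le] .
  moreover have "2 * a' \<le> 2 * a" using le by simp
  then have "\<forall>x\<in>B. \<exists>y\<in>T. dist y (u x) \<le> 2 * a" using B(3) order_trans by blast
  ultimately show "\<exists>h. continuous_map (subtopology X B) euclidean h \<and>
      (\<forall>x\<in>B. h x \<in> T \<and> dist (h x) (u x) \<le> b)"
    using push B(1) unfolding nearby_push_def by blast
qed

section \<open>Approximate selections and their limit\<close>

text \<open>
  The precision \<open>r\<close> of the new approximate selection is arbitrary, whereas its distance from the old one
  is determined by the precision \<open>e 0 / 4\<close> of the old one. Two sequences of tolerances appear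
  accordingly: \<open>e k\<close> bounds the distance from \<open>g\<close>, and \<open>\<eta> k\<close>, which depends on \<open>r\<close> as well, bounds
  the distance from the values of \<open>F\<close>.

  Lower semicontinuity gives information in one direction only: points of \<open>F z\<close> are close to
  \<open>F x\<close> if \<open>x\<close> is in a neighbourhood \<open>U z\<close> of \<open>z\<close>. So an admissible value at \<open>x\<close> is one close to \<open>F z\<close>
  for some \<open>z\<close> such that \<open>U z\<close> contains the star of \<open>x\<close> in the cover of the current step. The
  covers get finer with the steps, so that this star contains not only \<open>x\<close> but also the centre
  chosen in the next step, which is where the value is moved next.
\<close>
lemma improve_approximation:
  fixes F :: "'a \<Rightarrow> 'b::metric_space set"
  assumes X: "metrizable_space X" and lin: "Lindelof_space X" and S: "abs_ext X (nsphere n)"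
    and lsc: "\<And>x r. x \<in> topspace X \<Longrightarrow> 0 < r \<Longrightarrow>
          \<exists>V. openin X V \<and> x \<in> V \<and> (\<forall>z\<in>V. \<forall>p\<in>F x. \<exists>q\<in>F z. dist p q \<le> r)"
    and e: "ladder X n (F ` topspace X) e"
    and push: "\<And>b. 0 < b \<Longrightarrow> \<exists>a>0. \<forall>x\<in>topspace X. nearby_push X (F x) a b"
    and g: "osc_le X (topspace X) c g" "c < e 0 / 4"
    and gF: "\<And>x. x \<in> topspace X \<Longrightarrow> \<exists>p\<in>F x. dist p (g x) \<le> e 0 / 4"
    and r: "0 < r"
  shows "\<exists>h. osc_le X (topspace X) r h \<and>
    (\<forall>x\<in>topspace X. (\<exists>p\<in>F x. dist p (h x) \<le> r) \<and> dist (h x) (g x) \<le> e (Suc n))"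
proof -
  have e0: "0 < e 0" and eS: "\<And>k. k \<le> n \<Longrightarrow> e k \<le> e (Suc k) / 4"
    and ext: "\<And>k x. k \<le> n \<Longrightarrow> x \<in> topspace X \<Longrightarrow> controlled_ext X (F x) (4 * e k) (e (Suc k) / 4)"
    using e by (auto simp: ladder_def)
  \<comment> \<open>Monotonicity is built into \<open>R\<close>, so the least tolerance \<open>\<eta> 0\<close> can serve for lower semicontinuity.\<close>
  define R where "R a b \<longleftrightarrow> a \<le> b \<and> (\<forall>x\<in>topspace X. nearby_push X (F x) a b)" for a b
  have "\<exists>a>0. R a b" if b: "0 < b" for b
  proof -
    obtain a where a: "0 < a" "\<forall>x\<in>topspace X. nearby_push X (F x) a b" using push [OF b] by blast
    have "nearby_push X (F x) (min a b) b" if "x \<in> topspace X" for x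
      using nearby_push_antimono [of X "F x" a b "min a b"] a(2) that by simp
    then have "R (min a b) b" by (simp add: R_def)
    then show ?thesis using a(1) b by (intro exI [of _ "min a b"]) simp
  qed
  moreover have "0 < min (r / 2) (e 0 / 4)" using r e0 by simp
  ultimately have "\<exists>s. s (Suc n) = min (r / 2) (e 0 / 4) \<and> (\<forall>k\<le>Suc n. 0 < s k) \<and> (\<forall>k<Suc n. R (s k) (s (Suc k)))"
    by (rule descending_scales)
  then obtain \<eta> where \<eta>: "\<eta> (Suc n) = min (r / 2) (e 0 / 4)" "\<And>k. k \<le> Suc n \<Longrightarrow> 0 < \<eta> k"
      "\<And>k. k \<le> n \<Longrightarrow> R (\<eta> k) (\<eta> (Suc k))"
    by (auto simp: less_Suc_eq_le)
  have \<eta>_step: "\<eta> k \<le> \<eta> (Suc k)" if "k \<le> n" for k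
    using \<eta>(3) [OF that] by (simp add: R_def)
  have \<eta>_ge: "\<eta> 0 \<le> \<eta> k" if "k \<le> Suc n" for k
    using that
  proof (induction k)
    case (Suc k)
    then show ?case using \<eta>_step [of k] by simp
  qed simp
  have \<eta>_le: "\<eta> k \<le> \<eta> (Suc n)" if "k \<le> Suc n" for k
    using that
  proof (induction k rule: inc_induct)
    case (step k)
    then show ?case using \<eta>_step [of k] by simp
  qed simp
  have "\<exists>U. openin X U \<and> z \<in> U \<and> (\<forall>x\<in>U. dist (g x) (g z) \<le> e 0 / 4 \<and> (\<forall>p\<in>F z. \<exists>q\<in>F x. dist p q \<le> \<eta> 0))"
    if z: "z \<in> topspace X" for z
  proof -
    obtain V where V: "openin X V" "z \<in> V" "\<And>x. x \<in> V \<Longrightarrow> x \<in> topspace X \<Longrightarrow> dist (g x) (g z) < e 0 / 4"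
      using osc_leD [OF g(1) z g(2)] by metis
    obtain W where W: "openin X W" "z \<in> W" "\<forall>x\<in>W. \<forall>p\<in>F z. \<exists>q\<in>F x. dist p q \<le> \<eta> 0"
      using lsc [OF z, of "\<eta> 0"] \<eta>(2) [of 0] by blast
    have "openin X (V \<inter> W)" using V(1) W(1) by blast
    moreover have "dist (g x) (g z) \<le> e 0 / 4" if "x \<in> V" for x
      using V(3) [OF that] openin_subset [OF V(1)] that by (simp add: less_imp_le subset_iff)
    ultimately show ?thesis using V(2) W(2,3) by (intro exI [of _ "V \<inter> W"]) simp
  qed
  then have "\<exists>U. \<forall>z\<in>topspace X. openin X (U z) \<and> z \<in> U z \<and>
      (\<forall>x\<in>U z. dist (g x) (g z) \<le> e 0 / 4 \<and> (\<forall>p\<in>F z. \<exists>q\<in>F x. dist p q \<le> \<eta> 0))"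
    by (intro bchoice) blast
  then obtain U where U: "\<And>z. z \<in> topspace X \<Longrightarrow> openin X (U z) \<and> z \<in> U z"
      and Ug: "\<And>z x. z \<in> topspace X \<Longrightarrow> x \<in> U z \<Longrightarrow> dist (g x) (g z) \<le> e 0 / 4"
      and UF: "\<And>z x p. z \<in> topspace X \<Longrightarrow> x \<in> U z \<Longrightarrow> p \<in> F z \<Longrightarrow> \<exists>q\<in>F x. dist p q \<le> \<eta> 0"
    by blast
  \<comment> \<open>The covers \<open>\<W> k\<close> are fixed for all steps; step \<open>k\<close> uses the stars in \<open>\<W> (Suc k)\<close>, since \<open>\<W> 0\<close> is arbitrary.\<close>
  define cover where "cover \<V> \<longleftrightarrow> (\<forall>V\<in>\<V>. openin X V) \<and> \<Union>\<V> = topspace X" for \<V>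
  define centred where "centred \<W> \<V> \<longleftrightarrow> (\<forall>V\<in>\<V>. \<exists>z\<in>topspace X. \<exists>W\<in>\<W>. z \<in> W \<and> V \<subseteq> W \<and>
      (\<forall>V'\<in>\<V>. V \<inter> V' \<noteq> {} \<longrightarrow> V' \<subseteq> U z))" for \<W> \<V>
  have "\<exists>\<W>. \<forall>k. cover (\<W> k) \<and> centred (\<W> k) (\<W> (Suc k))"
  proof (rule dependent_nat_choice [where P = "\<lambda>_. cover" and Q = "\<lambda>_. centred"])
    show "\<exists>\<W>. cover \<W>" by (intro exI [of _ "{topspace X}"]) (simp add: cover_def)
    fix \<W> assume \<W>: "cover \<W>"
    then show "\<exists>\<V>. cover \<V> \<and> centred \<W> \<V>"
      using centred_refinement [OF X, of \<W> U] U unfolding cover_def centred_def by simp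
  qed
  then obtain \<W> where \<W>: "\<And>k. cover (\<W> k)" "\<And>k. centred (\<W> k) (\<W> (Suc k))" by blast
  have covE: "\<exists>V\<in>\<W> k. x \<in> V" if "x \<in> topspace X" for k x
    using \<W>(1) [of k] that unfolding cover_def by blast
  have refine: "\<exists>W\<in>\<W> k. V \<subseteq> W" if "k \<le> m" "V \<in> \<W> m" for k m V
  proof (rule refines_later [of \<W>, OF _ that])
    fix k V assume "V \<in> \<W> (Suc k)"
    then show "\<exists>W\<in>\<W> k. V \<subseteq> W" using \<W>(2) [of k] unfolding centred_def by blast
  qed
  define Q where "Q k x y \<longleftrightarrow> dist y (g x) \<le> e k \<and>
      (\<exists>z\<in>topspace X. (\<forall>V\<in>\<W> (Suc k). x \<in> V \<longrightarrow> V \<subseteq> U z) \<and> (\<exists>p\<in>F z. dist p y \<le> \<eta> k))" for k x y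
  have "\<exists>V. openin X V \<and> a \<in> V \<and> V \<in> \<W> (Suc (Suc n))" if a: "a \<in> topspace X" for a
  proof -
    obtain V where V: "V \<in> \<W> (Suc (Suc n))" "a \<in> V" using covE [OF a] by blast
    then have "openin X V" using \<W>(1) [of "Suc (Suc n)"] unfolding cover_def by blast
    then show ?thesis using V by blast
  qed
  then have "\<exists>D. \<forall>a\<in>topspace X. openin X (D a) \<and> a \<in> D a \<and> D a \<in> \<W> (Suc (Suc n))"
    by (intro bchoice) blast
  then obtain D where D: "\<And>a. a \<in> topspace X \<Longrightarrow> openin X (D a) \<and> a \<in> D a"
     and DW: "\<And>a. a \<in> topspace X \<Longrightarrow> D a \<in> \<W> (Suc (Suc n))" by blast
  obtain N :: "'a \<Rightarrow> nat set" where N: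
      "\<And>x. x \<in> topspace X \<Longrightarrow> finite (N x) \<and> N x \<noteq> {} \<and> card (N x) \<le> Suc n"
      "\<And>x. x \<in> topspace X \<Longrightarrow> \<exists>V. openin X V \<and> x \<in> V \<and> (\<forall>z\<in>V. N z \<subseteq> N x)"
      "\<And>x j. x \<in> topspace X \<Longrightarrow> j \<in> N x \<Longrightarrow> \<exists>a\<in>topspace X. \<forall>z\<in>topspace X. j \<in> N z \<longrightarrow> z \<in> D a"
    using finite_order_cover [OF S metrizable_imp_completely_regular_space [OF X] lin, of D] D
    by blast
  have "\<exists>h. osc_le X (topspace X) (\<eta> (Suc n)) h \<and> (\<forall>x\<in>topspace X. Q (Suc n) x (h x))"
  proof (rule extend_along_strata [where N = N])
    show "t1_space X" using X metrizable_imp_t1_space by blast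
    show "0 \<le> \<eta> k" if "k \<le> n" for k using \<eta>(2) [of k] that by simp
  next
    fix k x assume k: "k \<le> n" and x: "x \<in> topspace X"
    obtain V where V: "V \<in> \<W> (Suc k)" "x \<in> V" using covE [OF x] by blast
    then obtain z where z: "z \<in> topspace X" "\<forall>V'\<in>\<W> (Suc k). V \<inter> V' \<noteq> {} \<longrightarrow> V' \<subseteq> U z"
      using \<W>(2) [of k] unfolding centred_def by blast
    have zx: "\<forall>V'\<in>\<W> (Suc k). x \<in> V' \<longrightarrow> V' \<subseteq> U z" using z(2) V(2) by blast
    then have "x \<in> U z" using V by blast
    obtain p where p: "p \<in> F z" "dist p (g z) \<le> e 0 / 4" using gF [OF z(1)] by blast
    have "dist p (g x) \<le> e k"
      using dist_triangle2 [of p "g x" "g z"] p(2) Ug [OF z(1) \<open>x \<in> U z\<close>] ladder_mono [OF e, of k] k e0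
      by linarith
    then have "Q k x p" unfolding Q_def
      using z(1) zx p(1) \<eta>(2) [of k] k by (intro conjI bexI [of _ z] bexI [of _ p]) auto
    then show "\<exists>y. Q k x y" ..
  next
    fix k \<sigma> B u assume k: "k \<le> n" and \<sigma>: "\<sigma> \<noteq> {}" and B: "closedin X B" "B \<noteq> {}"
      and B\<sigma>: "\<And>x. x \<in> B \<Longrightarrow> \<sigma> \<subseteq> N x" and u: "osc_le X B (\<eta> k) u" "\<And>x. x \<in> B \<Longrightarrow> Q k x (u x)"
    have BX: "B \<subseteq> topspace X" using closedin_subset [OF B(1)] .
    define C where "C = {x \<in> topspace X. \<sigma> \<subseteq> N x}"
    have BC: "B \<subseteq> C" using BX B\<sigma> by (auto simp: C_def)
    obtain b where b: "b \<in> B" using B(2) by blast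
    obtain j where j: "j \<in> \<sigma>" using \<sigma> by blast
    obtain a where a: "a \<in> topspace X" "\<forall>z\<in>topspace X. j \<in> N z \<longrightarrow> z \<in> D a"
      using N(3) [of b j] B\<sigma> [OF b] j b BX by blast
    have "\<exists>V\<in>\<W> (Suc (Suc k)). D a \<subseteq> V"
      by (rule refine [OF _ DW [OF a(1)]]) (use k in simp)
    then obtain V where V: "V \<in> \<W> (Suc (Suc k))" "D a \<subseteq> V" by blast
    have CV: "C \<subseteq> V"
    proof
      fix x assume "x \<in> C"
      then have "x \<in> topspace X" "j \<in> N x" using j by (auto simp: C_def)
      then show "x \<in> V" using a(2) V(2) by blast
    qed
    obtain z W where z: "z \<in> topspace X" and W: "W \<in> \<W> (Suc k)" "z \<in> W" "V \<subseteq> W"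
      and zV: "\<forall>V'\<in>\<W> (Suc (Suc k)). V \<inter> V' \<noteq> {} \<longrightarrow> V' \<subseteq> U z"
      using bspec [OF \<W>(2) [of "Suc k", unfolded centred_def] V(1)] by blast
    have zC: "\<forall>V'\<in>\<W> (Suc (Suc k)). x \<in> V' \<longrightarrow> V' \<subseteq> U z" if "x \<in> C" for x
      using zV that CV by blast
    have CU: "x \<in> U z" if "x \<in> C" for x using zC [OF that] V(1) CV that by blast
    \<comment> \<open>The centre \<open>z\<close> of this step lies in \<open>U z'\<close> for every centre \<open>z'\<close> by which a value of \<open>u\<close> was admitted.\<close>
    have "\<exists>q\<in>F z. dist q (u x) \<le> 2 * \<eta> k" if x: "x \<in> B" for x
    proof -
      obtain z' p where z': "z' \<in> topspace X" "\<forall>V\<in>\<W> (Suc k). x \<in> V \<longrightarrow> V \<subseteq> U z'"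
        and p: "p \<in> F z'" "dist p (u x) \<le> \<eta> k"
        using u(2) [OF x] unfolding Q_def by blast
      have "z \<in> U z'" using z'(2) W x BC CV by blast
      then obtain q where q: "q \<in> F z" "dist p q \<le> \<eta> 0" using UF [OF z'(1) _ p(1)] by blast
      have "dist q (u x) \<le> 2 * \<eta> k"
        using dist_triangle3 [of q "u x" p] q(2) p(2) \<eta>_ge [of k] k by simp
      then show ?thesis using q(1) by blast
    qed
    then have near: "\<forall>x\<in>B. \<exists>q\<in>F z. dist q (u x) \<le> 2 * \<eta> k" by blast
    have "nearby_push X (F z) (\<eta> k) (\<eta> (Suc k))"
      using \<eta>(3) [OF k] z by (simp add: R_def)
    then have "\<exists>h. continuous_map (subtopology X B) euclidean h \<and>
        (\<forall>x\<in>B. h x \<in> F z \<and> dist (h x) (u x) \<le> \<eta> (Suc k))"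
      unfolding nearby_push_def using B(1) u(1) near by simp
    then obtain h where h: "continuous_map (subtopology X B) euclidean h"
        "\<And>x. x \<in> B \<Longrightarrow> h x \<in> F z" "\<And>x. x \<in> B \<Longrightarrow> dist (h x) (u x) \<le> \<eta> (Suc k)"
      by blast
    have small: "dist (g x) (g y) \<le> e 0 / 2" if "x \<in> C" "y \<in> C" for x y
      using Ug [OF z CU [OF that(1)]] Ug [OF z CU [OF that(2)]] dist_triangle2 [of "g x" "g y" "g z"]
      by linarith
    have \<eta>e: "\<eta> (Suc k) \<le> e 0 / 4" using \<eta>_le [of "Suc k"] k \<eta>(1) by simp
    have e0k: "e 0 \<le> e k" using ladder_mono [OF e, of k] k by simp
    have ug: "dist (u x) (g x) \<le> e k" if "x \<in> B" for x using u(2) [OF that] by (simp add: Q_def)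
    have hg: "dist (h x) (g x) \<le> \<eta> (Suc k) + e k" if "x \<in> B" for x
      using dist_triangle [of "h x" "g x" "u x"] h(3) [OF that] ug [OF that] by linarith
    have "dist (h x) (h y) \<le> 4 * e k" if "x \<in> B" "y \<in> B" for x y
    proof -
      have "dist (g x) (g y) \<le> e 0 / 2" using small that BC by blast
      then show ?thesis
        using dist_triangle_chain [of "h x" "h y" "g x" "g y"] hg [OF that(1)] hg [OF that(2)] \<eta>e e0k e0
        by (simp add: dist_commute)
    qed
    then obtain h' where h': "continuous_map X euclidean h'" "\<And>x. x \<in> topspace X \<Longrightarrow> h' x \<in> F z"
        "\<And>x. x \<in> B \<Longrightarrow> h' x = h x"
        "\<And>x y. x \<in> topspace X \<Longrightarrow> y \<in> topspace X \<Longrightarrow> dist (h' x) (h' y) \<le> e (Suc k) / 4"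
      using controlled_extD [OF ext [OF k z] B(1) h(1) h(2)] by blast
    have "osc_le X C (\<eta> (Suc k)) (\<lambda>x. if x \<in> B then u x else h' x)"
    proof (rule osc_le_superimpose [OF u(1) _ B(1) BC])
      show "C \<subseteq> topspace X" by (auto simp: C_def)
      then show "osc_le X C 0 h'"
        using h'(1) by (subst osc_le_0_iff_continuous) (auto simp: continuous_map_from_subtopology)
      show "dist (h' x) (u x) \<le> \<eta> (Suc k)" if "x \<in> B" for x using h(3) h'(3) that by simp
    qed (use \<eta>_step [OF k] \<eta>(2) [of "Suc k"] k in auto)
    moreover have "Q (Suc k) x (if x \<in> B then u x else h' x)" if x: "x \<in> C" for x
    proof (cases "x \<in> B")
      case True
      have "dist (u x) (g x) \<le> e (Suc k)" using ug [OF True] eS [OF k] e0k e0 by linarith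
      then show ?thesis unfolding Q_def using True z zC [OF x] h(2,3) [OF True]
        by (intro conjI bexI [of _ z] bexI [of _ "h x"]) auto
    next
      case False
      have xX: "x \<in> topspace X" "b \<in> topspace X" "b \<in> C" using x b BX BC by (auto simp: C_def)
      have "dist (h' x) (g x) \<le> e (Suc k)"
        using dist_triangle_chain [of "h' x" "g x" "h' b" "g b"] h'(4) [OF xX(1,2)] h'(3) [OF b]
          hg [OF b] small [OF xX(3) x] \<eta>e e0k eS [OF k] e0 by simp
      then show ?thesis unfolding Q_def using False z zC [OF x] h'(2) [OF xX(1)] \<eta>(2) [of "Suc k"] k
        by (intro conjI bexI [of _ z] bexI [of _ "h' x"]) auto
    qed
    ultimately show "\<exists>w. (\<forall>x\<in>B. w x = u x) \<and> osc_le X {x \<in> topspace X. \<sigma> \<subseteq> N x} (\<eta> (Suc k)) w \<and>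
        (\<forall>x\<in>topspace X. \<sigma> \<subseteq> N x \<longrightarrow> Q (Suc k) x (w x))"
      by (intro exI [of _ "\<lambda>x. if x \<in> B then u x else h' x"]) (simp add: C_def)
  qed (use N in auto)
  then obtain h where h: "osc_le X (topspace X) (\<eta> (Suc n)) h" "\<And>x. x \<in> topspace X \<Longrightarrow> Q (Suc n) x (h x)"
    by blast
  show ?thesis
  proof (intro exI [of _ h] conjI ballI)
    show "osc_le X (topspace X) r h" using osc_le_mono [OF h(1)] \<eta>(1) r by simp
    fix x assume x: "x \<in> topspace X"
    show "dist (h x) (g x) \<le> e (Suc n)" using h(2) [OF x] by (simp add: Q_def)
    obtain z p where z: "z \<in> topspace X" "\<forall>V\<in>\<W> (Suc (Suc n)). x \<in> V \<longrightarrow> V \<subseteq> U z"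
        and p: "p \<in> F z" "dist p (h x) \<le> \<eta> (Suc n)"
      using h(2) [OF x] unfolding Q_def by blast
    have "x \<in> U z" using covE [OF x, of "Suc (Suc n)"] z(2) by blast
    then obtain q where q: "q \<in> F x" "dist p q \<le> \<eta> 0" using UF [OF z(1) _ p(1)] by blast
    have "dist q (h x) \<le> r"
      using dist_triangle3 [of q "h x" p] q(2) p(2) \<eta>_ge [of "Suc n"] \<eta>(1) by simp
    then show "\<exists>p\<in>F x. dist p (h x) \<le> r" using q(1) by blast
  qed
qed

text \<open>
  The first approximation is a constant: for errors as large as \<open>M\<close>, the hypothesis \<open>large\<close> provides a
  ladder that starts at the scale of \<open>M\<close>. All later steps use the hypothesis \<open>small\<close>.
\<close>
lemma selection_exists:
  fixes F :: "'a \<Rightarrow> 'b::metric_space set"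
  assumes X: "metrizable_space X" and lin: "Lindelof_space X" and S: "abs_ext X (nsphere n)"
    and lsc: "\<And>x r. x \<in> topspace X \<Longrightarrow> 0 < r \<Longrightarrow>
          \<exists>V. openin X V \<and> x \<in> V \<and> (\<forall>z\<in>V. \<forall>p\<in>F x. \<exists>q\<in>F z. dist p q \<le> r)"
    and F: "\<And>x. x \<in> topspace X \<Longrightarrow> compact (F x)"
    and bound: "0 < M" "\<And>x. x \<in> topspace X \<Longrightarrow> \<exists>q\<in>F x. dist q y0 \<le> M"
    and small: "\<And>b. 0 < b \<Longrightarrow> \<exists>a>0. \<forall>x\<in>topspace X. controlled_ext X (F x) a b"
    and large: "\<And>x d. x \<in> topspace X \<Longrightarrow> controlled_ext X (F x) d M"
  shows "\<exists>g. continuous_map X euclidean g \<and> (\<forall>x\<in>topspace X. g x \<in> F x)"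
proof -
  have ladders: "\<exists>e. ladder X n (F ` topspace X) e \<and> e (Suc n) = b" if b: "0 < b" for b
  proof -
    define R where "R a b \<longleftrightarrow> a \<le> b / 4 \<and> (\<forall>x\<in>topspace X. controlled_ext X (F x) (4 * a) (b / 4))" for a b
    have "\<exists>a>0. R a b" if "0 < b" for b
    proof -
      have "0 < b / 4" using that by simp
      then obtain a where a: "0 < a" "\<forall>x\<in>topspace X. controlled_ext X (F x) a (b / 4)"
        using small by blast
      have "controlled_ext X (F x) (4 * min (a / 4) (b / 4)) (b / 4)" if "x \<in> topspace X" for x
        using controlled_ext_mono [of X "F x" a "b / 4"] a(2) that by simp
      then show ?thesis using a(1) that by (intro exI [of _ "min (a / 4) (b / 4)"]) (simp add: R_def)
    qed
    then obtain s where "s (Suc n) = b" "\<forall>k\<le>Suc n. 0 < s k" "\<forall>k<Suc n. R (s k) (s (Suc k))"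
      using descending_scales [of R b "Suc n"] b by blast
    then show ?thesis by (intro exI [of _ s]) (simp add: ladder_def R_def less_Suc_eq_le)
  qed
  have push: "\<exists>a>0. \<forall>x\<in>topspace X. nearby_push X (F x) a b" if b: "0 < b" for b
  proof -
    obtain e where e: "ladder X n (F ` topspace X) e" "e (Suc n) = b" using ladders [OF b] by blast
    have e0: "0 < e 0" using e(1) by (simp add: ladder_def)
    have "nearby_push X (F x) (e 0 / 4) b" if x: "x \<in> topspace X" for x
      unfolding nearby_push_def
    proof (intro allI impI, elim conjE)
      fix B u assume B: "closedin X B" "osc_le X B (e 0 / 4) u"
        and near: "\<forall>z\<in>B. \<exists>y\<in>F x. dist y (u z) \<le> 2 * (e 0 / 4)"
      have l: "ladder X n {F x} e" using e(1) x by (simp add: ladder_def)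
      have c: "e 0 / 4 < e 0 / 2" "2 * (e 0 / 4) \<le> e 0" using e0 by auto
      have "\<exists>y\<in>F x. dist y (u z) \<le> e 0" if "z \<in> B" for z using near that c(2) order_trans by blast
      then show "\<exists>h. continuous_map (subtopology X B) euclidean h \<and>
          (\<forall>z\<in>B. h z \<in> F x \<and> dist (h z) (u z) \<le> b)"
        using push_into_member [OF X lin S l B c(1)] unfolding e(2) by blast
    qed
    then show ?thesis using e0 by (intro exI [of _ "e 0 / 4"]) simp
  qed
  define approx where "approx r h \<longleftrightarrow> osc_le X (topspace X) r h \<and>
      (\<forall>x\<in>topspace X. \<exists>p\<in>F x. dist p (h x) \<le> r)" for r h
  have improve: "\<exists>h. approx r h \<and> (\<forall>x\<in>topspace X. dist (h x) (g x) \<le> e (Suc n))"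
    if e: "ladder X n (F ` topspace X) e" and g: "osc_le X (topspace X) c g" "c < e 0 / 4"
      "\<And>x. x \<in> topspace X \<Longrightarrow> \<exists>p\<in>F x. dist p (g x) \<le> e 0 / 4" and r: "0 < r" for e c g r
    using improve_approximation [OF X lin S lsc e push g r] unfolding approx_def by blast
  have start: "\<exists>h. approx r h" if r: "0 < r" for r
  proof -
    define e where "e k = M * 4 ^ Suc k" for k
    have "ladder X n (F ` topspace X) e"
      unfolding ladder_def
    proof (intro conjI allI impI ballI)
      show "0 < e 0" using bound(1) by (simp add: e_def)
      fix k assume "k \<le> n"
      show "e k \<le> e (Suc k) / 4" by (simp add: e_def)
      have "M * 1 \<le> M * 4 ^ Suc k" using bound(1) by (intro mult_left_mono one_le_power) auto
      then have "M \<le> e (Suc k) / 4" by (simp add: e_def)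
      fix T assume "T \<in> F ` topspace X"
      then obtain x where x: "x \<in> topspace X" "T = F x" by blast
      show "controlled_ext X T (4 * e k) (e (Suc k) / 4)"
        unfolding x(2)
        by (rule controlled_ext_mono [OF large [OF x(1)] order_refl \<open>M \<le> e (Suc k) / 4\<close>])
    qed
    moreover have "osc_le X (topspace X) 0 (\<lambda>_. y0)"
      by (subst osc_le_0_iff_continuous) auto
    ultimately show ?thesis
      using improve [of e 0 "\<lambda>_. y0" r] bound r by (auto simp: e_def)
  qed
  have "\<exists>a>0. a \<le> (1/2)^m \<and> (\<forall>g r. approx a g \<and> 0 < r \<longrightarrow>
      (\<exists>h. approx r h \<and> (\<forall>x\<in>topspace X. dist (h x) (g x) \<le> (1/2)^m)))" for m :: nat
  proof -
    obtain e where e: "ladder X n (F ` topspace X) e" "e (Suc n) = (1/2)^m"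
      using ladders [of "(1/2)^m"] by auto
    define a where "a = min ((1/2)^m) (e 0 / 8)"
    have e0: "0 < e 0" using e(1) by (simp add: ladder_def)
    have a: "0 < a" "a \<le> (1/2)^m" "a < e 0 / 4" using e0 by (auto simp: a_def min_def)
    have "\<exists>h. approx r h \<and> (\<forall>x\<in>topspace X. dist (h x) (g x) \<le> (1/2)^m)" if "approx a g" "0 < r" for g r
    proof -
      have "\<exists>p\<in>F x. dist p (g x) \<le> e 0 / 4" if "x \<in> topspace X" for x
        using \<open>approx a g\<close> that a(3) unfolding approx_def by (meson less_imp_le order_trans)
      then show ?thesis
        using improve [OF e(1) _ a(3), of g r] that unfolding approx_def e(2) by simp
    qed
    then show ?thesis using a(1,2) by (intro exI [of _ a]) simp
  qed
  then obtain a where a: "\<And>m. 0 < a m" "\<And>m. a m \<le> (1/2)^m"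
    and next_approx: "\<And>m g r. approx (a m) g \<Longrightarrow> 0 < r \<Longrightarrow>
      \<exists>h. approx r h \<and> (\<forall>x\<in>topspace X. dist (h x) (g x) \<le> (1/2)^m)"
    by metis
  have "\<exists>G. \<forall>m. approx (a m) (G m) \<and> (\<forall>x\<in>topspace X. dist (G (Suc m) x) (G m x) \<le> (1/2)^m)"
  proof (rule dependent_nat_choice [where P = "\<lambda>m g. approx (a m) g"
        and Q = "\<lambda>m g h. \<forall>x\<in>topspace X. dist (h x) (g x) \<le> (1/2)^m"])
    show "\<exists>g. approx (a 0) g" using start a(1) by blast
    show "\<exists>h. approx (a (Suc m)) h \<and> (\<forall>x\<in>topspace X. dist (h x) (g x) \<le> (1/2)^m)"
      if "approx (a m) g" for g m
      using next_approx [OF that a(1)] .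
  qed
  then obtain G where G: "\<And>m. approx (a m) (G m)"
      and G_step: "\<And>m x. x \<in> topspace X \<Longrightarrow> dist (G (Suc m) x) (G m x) \<le> (1/2)^m" by blast
  have G_osc: "osc_le X (topspace X) ((1/2)^m) (G m)" for m
    using G [of m] osc_le_mono a(2) unfolding approx_def by blast
  have tail: "dist (G m x) (G (m + l) x) \<le> 2 * (1/2)^m - 2 * (1/2)^(m + l)" if x: "x \<in> topspace X" for m l x
  proof (induction l)
    case (Suc l)
    have "dist (G m x) (G (m + Suc l) x) \<le> dist (G m x) (G (m + l) x) + dist (G (Suc (m + l)) x) (G (m + l) x)"
      using dist_triangle2 [of "G m x" "G (m + Suc l) x" "G (m + l) x"] by simp
    then show ?case using Suc G_step [OF x, of "m + l"] by simp
  qed simp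
  \<comment> \<open>The ambient space need not be complete, but nearby points of \<open>F x\<close> have a limit point there.\<close>
  have "\<exists>l\<in>F x. \<forall>m. dist (G m x) l \<le> 2 * (1/2)^m" if x: "x \<in> topspace X" for x
  proof -
    have "\<exists>p\<in>F x. dist p (G m x) \<le> (1/2)^m" for m
      using G [of m] x a(2) [of m] unfolding approx_def by (meson order_trans)
    then obtain p where p: "\<And>m. p m \<in> F x" "\<And>m. dist (p m) (G m x) \<le> (1/2)^m" by metis
    obtain l r where l: "l \<in> F x" and r: "strict_mono r" "(p \<circ> r) \<longlonglongrightarrow> l"
      using F [OF x] p(1) unfolding compact_def by blast
    have "dist (G m x) l \<le> 2 * (1/2)^m" for m
    proof (rule LIMSEQ_le_const2)
      show "(\<lambda>i. dist (G m x) ((p \<circ> r) i)) \<longlonglongrightarrow> dist (G m x) l"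
        by (intro tendsto_intros r)
      have "dist (G m x) ((p \<circ> r) i) \<le> 2 * (1/2)^m" if i: "m \<le> i" for i
      proof -
        have mr: "m \<le> r i" using i seq_suble [OF r(1), of i] by simp
        then have "dist (G m x) (G (r i) x) \<le> 2 * (1/2)^m - 2 * (1/2)^(r i)"
          using tail [OF x, of m "r i - m"] by simp
        moreover have "0 \<le> (1/2 :: real)^(r i)" by simp
        ultimately show ?thesis
          using dist_triangle2 [of "G m x" "p (r i)" "G (r i) x"] p(2) [of "r i"] unfolding o_def by linarith
      qed
      then show "\<exists>N. \<forall>i\<ge>N. dist (G m x) ((p \<circ> r) i) \<le> 2 * (1/2)^m" by blast
    qed
    then show ?thesis using l by blast
  qed
  then obtain g where g: "\<And>x. x \<in> topspace X \<Longrightarrow> g x \<in> F x"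
      "\<And>x m. x \<in> topspace X \<Longrightarrow> dist (G m x) (g x) \<le> 2 * (1/2)^m"
    by metis
  have "osc_le X (topspace X) 0 g"
    unfolding osc_le_def
  proof (intro ballI allI impI)
    fix x and r :: real assume x: "x \<in> topspace X" and r: "0 < r"
    obtain m where m: "(1/2)^m < r / 6"
      using real_arch_pow_inv [of "r / 6" "1/2"] r by auto
    have "(1/2)^m < 2 * (1/2 :: real)^m" by simp
    then obtain V where V: "openin X V" "x \<in> V"
        "\<And>z. z \<in> V \<Longrightarrow> z \<in> topspace X \<Longrightarrow> dist (G m z) (G m x) < 2 * (1/2)^m"
      using osc_leD [OF G_osc [of m] x] by metis
    have "dist (g z) (g x) < r" if "z \<in> V" "z \<in> topspace X" for z
      using dist_triangle_chain [of "g z" "g x" "G m z" "G m x"] g(2) [OF x, of m] g(2) [OF that(2), of m]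
        V(3) [OF that] m dist_commute [of "g z" "G m z"] by linarith
    then show "\<exists>V. openin X V \<and> x \<in> V \<and> (\<forall>z\<in>V \<inter> topspace X. dist (g z) (g x) < r)"
      using V(1,2) by blast
  qed
  then have "continuous_map X euclidean g"
    using osc_le_0_iff_continuous [of "topspace X" X g] by simp
  then show ?thesis using g(1) by blast
qed

section \<open>The selection theorem\<close>

lemma polish_imp_Lindelof_space:
  assumes "polish X"
  shows "Lindelof_space X"
proof (rule second_countable_imp_Lindelof_space)
  obtain M d where "Metric_space M d" and X: "X = Metric_space.mtopology M d"
    using assms by (auto simp: polish_def completely_metrizable_space_def)
  interpret Metric_space M d by fact
  obtain C where C: "countable C" "C \<subseteq> M" "mtopology closure_of C = M"
    using assms by (auto simp: polish_def separable_space_def X)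
  define \<B> where "\<B> = (\<lambda>(q, n). mball q (inverse (Suc n))) ` (C \<times> UNIV)"
  have "countable \<B>" unfolding \<B>_def using C(1) by (intro countable_image countable_SIGMA) auto
  moreover have "\<forall>V\<in>\<B>. openin X V" by (auto simp: \<B>_def X)
  moreover have "\<exists>V\<in>\<B>. x \<in> V \<and> V \<subseteq> U" if U: "openin X U" "x \<in> U" for U x
  proof -
    obtain r where r: "0 < r" "mball x r \<subseteq> U" and x: "x \<in> M"
      using U unfolding X openin_mtopology by blast
    obtain n where n: "inverse (real (Suc n)) < r / 2" using reals_Archimedean [of "r / 2"] r(1) by auto
    have "x \<in> mtopology closure_of C" using C(3) x by simp
    then obtain q where q: "q \<in> C" "q \<in> mball x (inverse (Suc n))"
      unfolding metric_closure_of by (force dest: spec [of _ "inverse (real (Suc n))"])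
    have "mball q (inverse (Suc n)) \<subseteq> mball x r"
      by (rule mball_subset) (use q n x commute [of x q] in auto)
    moreover have "x \<in> mball q (inverse (Suc n))" using q x C(2) commute [of x q] by auto
    moreover have "mball q (inverse (Suc n)) \<in> \<B>" using q(1) by (auto simp: \<B>_def)
    ultimately show ?thesis using r(2) by blast
  qed
  ultimately show "second_countable X" unfolding second_countable_def by blast
qed

text \<open>
  Since \<open>F x\<close> is compact, a finite net in it suffices, and only finitely many open conditions arise.
\<close>
lemma lower_semicontinuous_uniformly:
  fixes F :: "'a \<Rightarrow> 'b::metric_space set"
  assumes lsc: "lower_semicontinuous X (top_of_set Y) F" and FY: "F x \<subseteq> Y" and F: "compact (F x)"
    and x: "x \<in> topspace X" and r: "0 < r"
  shows "\<exists>V. openin X V \<and> x \<in> V \<and> (\<forall>z\<in>V. \<forall>p\<in>F x. \<exists>q\<in>F z. dist p q \<le> r)"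
proof -
  have "0 < r / 2" using r by simp
  then obtain K where K: "finite K" "K \<subseteq> F x" "F x \<subseteq> (\<Union>k\<in>K. ball k (r / 2))"
    using compactE_image [OF F, of "F x" "\<lambda>k. ball k (r / 2)"] by (metis UN_I centre_in_ball open_ball subsetI)
  define W where "W k = {z \<in> topspace X. F z \<inter> (Y \<inter> ball k (r / 2)) \<noteq> {}}" for k
  have W: "openin X (W k)" for k
    using lsc unfolding lower_semicontinuous_def W_def by (simp add: openin_open_Int)
  have xW: "x \<in> W k" if "k \<in> K" for k
  proof -
    have "k \<in> F x \<inter> (Y \<inter> ball k (r / 2))" using that K(2) FY r by auto
    then show ?thesis using x unfolding W_def by blast
  qed
  have "openin X (\<Inter>(insert (topspace X) (W ` K)))"
    by (rule openin_Inter) (use K(1) W in auto)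
  moreover have "x \<in> \<Inter>(insert (topspace X) (W ` K))" using xW x by simp
  moreover have "\<exists>q\<in>F z. dist p q \<le> r"
    if z: "z \<in> \<Inter>(insert (topspace X) (W ` K))" and p: "p \<in> F x" for z p
  proof -
    obtain k where k: "k \<in> K" "dist k p < r / 2" using K(3) p by auto
    then have "z \<in> W k" using z by simp
    then obtain q where q: "q \<in> F z" "dist k q < r / 2" by (auto simp: W_def)
    have "dist p q \<le> r" using dist_triangle3 [of p q k] k(2) q(2) by simp
    then show ?thesis using q(1) by blast
  qed
  ultimately show ?thesis by (intro exI [of _ "\<Inter>(insert (topspace X) (W ` K))"] conjI ballI)
qed

theorem theorem3p1:
  fixes L :: "'l topology" and n :: nat
    and X :: "'x topology" and Y :: "'y::metric_space set"
    and F :: "'x \<Rightarrow> 'y set" and A :: "'x set" and f :: "'x \<Rightarrow> 'y"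
  assumes "cplx L" and "ext_le L (nsphere n)"
    and "compact Y"
    and "polish X" and "ed_le X L"
    and "many_valued_map X (top_of_set Y) F"
    and "lower_semicontinuous X (top_of_set Y) F"
    and "equi_LC L (F ` topspace X)"
    and "\<And>x. x \<in> topspace X \<Longrightarrow> abs_ext_mod L (top_of_set (F x))"
    and "closedin X A"
    and "selection_on X (top_of_set Y) F A f"
  shows "\<exists>g. selection_on X (top_of_set Y) F (topspace X) g \<and> (\<forall>x\<in>A. g x = f x)"
proof -
  have X: "metrizable_space X" "Lindelof_space X"
    using \<open>polish X\<close> completely_metrizable_imp_metrizable_space polish_imp_Lindelof_space
    by (auto simp: polish_def)
  have S: "abs_ext X (nsphere n)"
    using ext_leD [OF \<open>ext_le L (nsphere n)\<close> \<open>polish X\<close>] ed_le_iff [OF \<open>polish X\<close> \<open>cplx L\<close>] \<open>ed_le X L\<close>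
    by blast
  obtain Z :: "real topology" where Z: "X homeomorphic_space Z" "polish Z"
    using polish_real_copy [OF \<open>polish X\<close>] by blast
  have edZ: "ed_le Z L"
    using \<open>ed_le X L\<close> abs_ext_homeomorphic_domain [OF Z(1)] unfolding ed_le_def by blast
  have FY: "F x \<subseteq> Y" if "x \<in> topspace X" for x
    using \<open>many_valued_map X (top_of_set Y) F\<close> that by (simp add: many_valued_map_def)
  have F: "compact (F x)" if "x \<in> topspace X" for x
  proof -
    have "closedin (top_of_set Y) (F x)"
      using \<open>lower_semicontinuous X (top_of_set Y) F\<close> that by (simp add: lower_semicontinuous_def)
    then show ?thesis using \<open>compact Y\<close> by (rule closedin_compact [rotated])
  qed
  have FX: "abs_ext X (top_of_set (F x))" if "x \<in> topspace X" for x
    using assms(9) [OF that] Z(2) edZ abs_ext_homeomorphic_domain homeomorphic_space_sym [of X Z] Z(1)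
    unfolding abs_ext_mod_def by blast
  have fc: "continuous_map (subtopology X A) euclidean f" and fF: "\<And>x. x \<in> A \<Longrightarrow> f x \<in> F x"
    using \<open>selection_on X (top_of_set Y) F A f\<close>
    by (auto simp: selection_on_def continuous_map_in_subtopology)
  have AX: "A \<subseteq> topspace X" using closedin_subset [OF \<open>closedin X A\<close>] .
  \<comment> \<open>A selection of \<open>G\<close> is a selection of \<open>F\<close> extending \<open>f\<close>.\<close>
  define G where "G x = (if x \<in> A then {f x} else F x)" for x
  have GF: "G x \<subseteq> F x" for x using fF by (simp add: G_def)
  define M where "M = diameter Y + 1"
  have "bounded Y" using \<open>compact Y\<close> by (rule compact_imp_bounded)
  have M: "dist p q \<le> M" if "p \<in> Y" "q \<in> Y" for p q
    using diameter_bounded_bound [OF \<open>bounded Y\<close> that] by (simp add: M_def)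
  have M0: "0 < M" using diameter_ge_0 [OF \<open>bounded Y\<close>] by (simp add: M_def)
  \<comment> \<open>The empty map into \<open>F x\<close> extends over \<open>X\<close>.\<close>
  have Gne: "G x \<noteq> {}" if x: "x \<in> topspace X" for x
  proof -
    have "\<exists>g. continuous_map X (top_of_set (F x)) g \<and> (\<forall>z\<in>{}. g z = f z)"
      using FX [OF x] unfolding abs_ext_def
      by (elim allE [of _ "{}"] allE [of _ f] impE) (auto simp: continuous_map_def)
    then obtain g where "continuous_map X (top_of_set (F x)) g" by blast
    then have "g x \<in> F x" using x by (auto simp: continuous_map_in_subtopology)
    then show ?thesis by (auto simp: G_def)
  qed
  obtain y0 where y0: "\<And>x. x \<in> topspace X \<Longrightarrow> \<exists>q\<in>G x. dist q y0 \<le> M"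
  proof (cases "topspace X = {}")
    case False
    then obtain x0 where "x0 \<in> topspace X" by blast
    then obtain y where y: "y \<in> Y" using Gne [of x0] GF [of x0] FY [of x0] by blast
    have "\<exists>q\<in>G x. dist q y \<le> M" if x: "x \<in> topspace X" for x
    proof -
      obtain q where q: "q \<in> G x" using Gne [OF x] by blast
      then have "q \<in> Y" using GF FY [OF x] by blast
      then show ?thesis using M y q by blast
    qed
    then show ?thesis by (rule that)
  qed (use that in simp)
  have small: "\<exists>a>0. \<forall>x\<in>topspace X. controlled_ext X (G x) a b" if b: "0 < b" for b
  proof -
    obtain \<delta> where \<delta>: "0 < \<delta>" "\<forall>T\<in>F ` topspace X. \<forall>(Z :: real topology) A f.
        polish Z \<and> ed_le Z L \<and> closedin Z A \<and>
        continuous_map (subtopology Z A) (top_of_set T) f \<and> diameter (f ` A) < \<delta> \<longrightarrow>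
        (\<exists>g. continuous_map Z (top_of_set T) g \<and> (\<forall>x\<in>A. g x = f x) \<and>
             diameter (g ` topspace Z) < b)"
      using \<open>equi_LC L (F ` topspace X)\<close> b unfolding equi_LC_def by blast
    have "controlled_ext X (G x) (\<delta> / 2) b" if x: "x \<in> topspace X" for x
    proof (cases "x \<in> A")
      case True
      then show ?thesis using controlled_ext_singleton [of b X "f x"] b by (simp add: G_def)
    next
      case False
      have "controlled_ext X (F x) (\<delta> / 2) b"
      proof (rule controlled_ext_via_copy [OF Z(1)])
        show "bounded (F x)" using F [OF x] compact_imp_bounded by blast
        show "0 \<le> \<delta> / 2" "\<delta> / 2 < \<delta>" using \<delta>(1) by auto
      qed (use \<delta>(2) x Z(2) edZ in blast)
      then show ?thesis using False by (simp add: G_def)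
    qed
    then show ?thesis using \<delta>(1) by (intro exI [of _ "\<delta> / 2"]) simp
  qed
  have large: "controlled_ext X (G x) d M" if x: "x \<in> topspace X" for x d
  proof (cases "x \<in> A")
    case True
    then show ?thesis using controlled_ext_singleton [of M X "f x"] M0 by (simp add: G_def)
  next
    case False
    have "controlled_ext X (F x) d M"
      by (rule controlled_ext_abs_ext [OF FX [OF x]]) (use M FY [OF x] in blast)
    then show ?thesis using False by (simp add: G_def)
  qed
  have lsc: "\<exists>V. openin X V \<and> x \<in> V \<and> (\<forall>z\<in>V. \<forall>p\<in>G x. \<exists>q\<in>G z. dist p q \<le> r)"
    if x: "x \<in> topspace X" and r: "0 < r" for x r
  proof -
    obtain V where V: "openin X V" "x \<in> V" "\<And>z p. z \<in> V \<Longrightarrow> p \<in> F x \<Longrightarrow> \<exists>q\<in>F z. dist p q \<le> r"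
      using lower_semicontinuous_uniformly [OF assms(7) FY [OF x] F [OF x] x r] by blast
    show ?thesis
    proof (cases "x \<in> A")
      case True
      have "osc_le X A 0 f" using osc_le_0_iff_continuous [OF AX] fc by blast
      then obtain W where W: "openin X W" "x \<in> W" "\<And>z. z \<in> W \<Longrightarrow> z \<in> A \<Longrightarrow> dist (f z) (f x) < r"
        using osc_leD [OF _ True r] by metis
      have "openin X (V \<inter> W)" using V(1) W(1) by blast
      moreover have "\<exists>q\<in>G z. dist p q \<le> r" if z: "z \<in> V \<inter> W" and p: "p \<in> G x" for z p
      proof (cases "z \<in> A")
        case True
        have "p = f x" using p \<open>x \<in> A\<close> by (simp add: G_def)
        then show ?thesis using True W(3) [of z] z by (simp add: G_def dist_commute less_imp_le)
      next
        case False
        then show ?thesis using V(3) [of z p] z p GF by (auto simp: G_def)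
      qed
      ultimately show ?thesis using V(2) W(2) by blast
    next
      case False
      have "openin X (V - A)" using V(1) \<open>closedin X A\<close> by blast
      moreover have "\<exists>q\<in>G z. dist p q \<le> r" if "z \<in> V - A" "p \<in> G x" for z p
        using V(3) [of z p] that False by (simp add: G_def)
      ultimately show ?thesis using V(2) False by blast
    qed
  qed
  have compact_G: "compact (G x)" if "x \<in> topspace X" for x using F [OF that] by (simp add: G_def)
  have "\<exists>g. continuous_map X euclidean g \<and> (\<forall>x\<in>topspace X. g x \<in> G x)"
    by (rule selection_exists [OF X S lsc compact_G M0 y0 small large])
  then obtain g where g: "continuous_map X euclidean g" "\<And>x. x \<in> topspace X \<Longrightarrow> g x \<in> G x"
    by blast
  have "g x \<in> F x" if "x \<in> topspace X" for x using g(2) [OF that] GF by blast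
  moreover have "g x = f x" if "x \<in> A" for x using g(2) [of x] that AX by (auto simp: G_def)
  moreover have "continuous_map X (top_of_set Y) g"
    using g(1) calculation(1) FY by (auto simp: continuous_map_in_subtopology)
  ultimately show ?thesis
    by (intro exI [of _ g]) (simp add: selection_on_def)
qed

end
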